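(* In the two-group random mixture model, let $\mathsf{EFN}^*_n(\alpha)$ denote the optimal (smallest) $\mathrm{EFN}$ subject to the constraint that the FDR is at most $\alpha$, with $n$ hypotheses. For every $\alpha\in[0,1]$ the limit $\mathsf{EFN}^*(\alpha)=\lim_{n\to\infty}\mathsf{EFN}^*_n(\alpha)$ exists, and, as a function of $\alpha$, it is the greatest convex minorant on $[0,1]$ of the function $\mathsf{mEFN}^*$.
   Context: Two-group random mixture model: $\pi_0,\pi_1\in(0,1)$ with $\pi_0+\pi_1=1$; $f_0,f_1$ are probability densities on a sample space $\mathcal X$ (with respect to a common dominating measure). The labels $\theta_1,\dots,\theta_n$ are iid $\mathrm{Bern}(\pi_1)$ and, conditionally on $\theta^n$, the observations $X_1,\dots,X_n$ are independent with $X_i\sim f_{\theta_i}$. A (possibly randomized) decision rule $\delta^n=(\delta_1,\dots,\delta_n)$ is given by a Markov kernel from $\mathcal X^n$ to $\{0,1\}^n$ applied to $X^n$ (so $\delta^n$ is conditionally independent of $\theta^n$ given $X^n$). Define $\mathrm{FDR}(\delta^n)=\mathbb E\Big[\frac{\sum_i\delta_i(1-\theta_i)}{1\vee\sum_i\delta_i}\Big]$, $\mathrm{mFDR}(\delta^n)=\frac{\mathbb E[\sum_i\delta_i(1-\theta_i)]}{\mathbb E[\sum_i\delta_i]}$ (with $0/0=0$), and $\mathrm{EFN}(\delta^n)=\frac1n\mathbb E[\sum_{i=1}^n\theta_i(1-\delta_i)]$. $\mathsf{EFN}^*_n(\alpha)=\inf\{\mathrm{EFN}(\delta^n):\mathrm{FDR}(\delta^n)\le\alpha\}$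 and $\mathsf{mEFN}^*(\alpha)=\inf\{\mathrm{EFN}(\delta^n):\mathrm{mFDR}(\delta^n)\le\alpha\}$, infima over all decision rules; the latter value does not depend on $n$. The greatest convex minorant of $h:[0,1]\to\mathbb R$ is the pointwise supremum of all convex functions $C$ on $[0,1]$ with $C\le h$. *)

theory Defs
  imports "HOL-Probability.Probability"
begin

definition prob_density :: "'a measure \<Rightarrow> ('a \<Rightarrow> real) \<Rightarrow> bool" where
  "prob_density M f \<longleftrightarrow>
     f \<in> borel_measurable M \<and> (\<forall>x\<in>space M. 0 \<le> f x) \<and> (\<integral>\<^sup>+x. ennreal (f x) \<partial>M) = 1"

text \<open>Vectors indexed by the \<open>n\<close> hypotheses are functions on \<open>{..<n}\<close>, with the usual product
  sigma-algebra; for labels \<open>True\<close> means non-null, for decisions \<open>True\<close> means rejection.\<close>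

definition obs_space :: "'a measure \<Rightarrow> nat \<Rightarrow> (nat \<Rightarrow> 'a) measure" where
  "obs_space M n = (\<Pi>\<^sub>M i\<in>{..<n}. M)"

definition binary_space :: "nat \<Rightarrow> (nat \<Rightarrow> bool) measure" where
  "binary_space n = (\<Pi>\<^sub>M i\<in>{..<n}. count_space UNIV)"

definition decision_rule ::
    "'a measure \<Rightarrow> nat \<Rightarrow> ((nat \<Rightarrow> 'a) \<Rightarrow> (nat \<Rightarrow> bool) measure) \<Rightarrow> bool" where
  "decision_rule M n K \<longleftrightarrow> K \<in> obs_space M n \<rightarrow>\<^sub>M prob_algebra (binary_space n)"

definition label_law :: "real \<Rightarrow> nat \<Rightarrow> (nat \<Rightarrow> bool) measure" where
  "label_law \<pi>1 n = (\<Pi>\<^sub>M i\<in>{..<n}. measure_pmf (bernoulli_pmf \<pi>1))"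

definition obs_law ::
    "'a measure \<Rightarrow> ('a \<Rightarrow> real) \<Rightarrow> ('a \<Rightarrow> real) \<Rightarrow> nat \<Rightarrow> (nat \<Rightarrow> bool) \<Rightarrow> (nat \<Rightarrow> 'a) measure" where
  "obs_law M f0 f1 n \<theta> =
     (\<Pi>\<^sub>M i\<in>{..<n}. density M (\<lambda>x. ennreal (if \<theta> i then f1 x else f0 x)))"

text \<open>Joint law of labels, observations and decisions. The kernel \<open>K\<close> sees only the observations,
  so the decisions are conditionally independent of the labels given the observations.\<close>

definition joint_law ::
    "real \<Rightarrow> 'a measure \<Rightarrow> ('a \<Rightarrow> real) \<Rightarrow> ('a \<Rightarrow> real) \<Rightarrow> nat \<Rightarrow>
     ((nat \<Rightarrow> 'a) \<Rightarrow> (nat \<Rightarrow> bool) measure) \<Rightarrow>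
     ((nat \<Rightarrow> bool) \<times> (nat \<Rightarrow> 'a) \<times> (nat \<Rightarrow> bool)) measure" where
  "joint_law \<pi>1 M f0 f1 n K =
     label_law \<pi>1 n \<bind> (\<lambda>\<theta>.
     obs_law M f0 f1 n \<theta> \<bind> (\<lambda>x.
     K x \<bind> (\<lambda>\<delta>.
     return (binary_space n \<Otimes>\<^sub>M obs_space M n \<Otimes>\<^sub>M binary_space n) (\<theta>, x, \<delta>))))"

definition rejections :: "nat \<Rightarrow> (nat \<Rightarrow> bool) \<Rightarrow> real" where
  "rejections n \<delta> = (\<Sum>i<n. of_bool (\<delta> i))"

definition false_discoveries :: "nat \<Rightarrow> (nat \<Rightarrow> bool) \<Rightarrow> (nat \<Rightarrow> bool) \<Rightarrow> real" where
  "false_discoveries n \<theta> \<delta> = (\<Sum>i<n. of_bool (\<delta> i) * (1 - of_bool (\<theta> i)))"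

definition false_negatives :: "nat \<Rightarrow> (nat \<Rightarrow> bool) \<Rightarrow> (nat \<Rightarrow> bool) \<Rightarrow> real" where
  "false_negatives n \<theta> \<delta> = (\<Sum>i<n. of_bool (\<theta> i) * (1 - of_bool (\<delta> i)))"

definition FDR ::
    "real \<Rightarrow> 'a measure \<Rightarrow> ('a \<Rightarrow> real) \<Rightarrow> ('a \<Rightarrow> real) \<Rightarrow> nat \<Rightarrow>
     ((nat \<Rightarrow> 'a) \<Rightarrow> (nat \<Rightarrow> bool) measure) \<Rightarrow> real" where
  "FDR \<pi>1 M f0 f1 n K =
     (\<integral>(\<theta>, x, \<delta>). false_discoveries n \<theta> \<delta> / max 1 (rejections n \<delta>) \<partial>joint_law \<pi>1 M f0 f1 n K)"

text \<open>The convention \<open>0/0 = 0\<close> is that of division in HOL.\<close>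

definition mFDR ::
    "real \<Rightarrow> 'a measure \<Rightarrow> ('a \<Rightarrow> real) \<Rightarrow> ('a \<Rightarrow> real) \<Rightarrow> nat \<Rightarrow>
     ((nat \<Rightarrow> 'a) \<Rightarrow> (nat \<Rightarrow> bool) measure) \<Rightarrow> real" where
  "mFDR \<pi>1 M f0 f1 n K =
     (\<integral>(\<theta>, x, \<delta>). false_discoveries n \<theta> \<delta> \<partial>joint_law \<pi>1 M f0 f1 n K) /
     (\<integral>(\<theta>, x, \<delta>). rejections n \<delta> \<partial>joint_law \<pi>1 M f0 f1 n K)"

definition EFN ::
    "real \<Rightarrow> 'a measure \<Rightarrow> ('a \<Rightarrow> real) \<Rightarrow> ('a \<Rightarrow> real) \<Rightarrow> nat \<Rightarrow>
     ((nat \<Rightarrow> 'a) \<Rightarrow> (nat \<Rightarrow> bool) measure) \<Rightarrow> real" where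
  "EFN \<pi>1 M f0 f1 n K =
     1 / real n * (\<integral>(\<theta>, x, \<delta>). false_negatives n \<theta> \<delta> \<partial>joint_law \<pi>1 M f0 f1 n K)"

text \<open>For \<open>\<alpha> \<ge> 0\<close> both infima are over nonempty sets (the rule that never rejects is feasible)
  bounded below by \<open>0\<close>, so the conditionally complete \<open>Inf\<close> on the reals is the true infimum.\<close>

definition EFN_opt ::
    "real \<Rightarrow> 'a measure \<Rightarrow> ('a \<Rightarrow> real) \<Rightarrow> ('a \<Rightarrow> real) \<Rightarrow> nat \<Rightarrow> real \<Rightarrow> real" where
  "EFN_opt \<pi>1 M f0 f1 n \<alpha> =
     Inf {EFN \<pi>1 M f0 f1 n K |K. decision_rule M n K \<and> FDR \<pi>1 M f0 f1 n K \<le> \<alpha>}"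

definition mEFN_opt ::
    "real \<Rightarrow> 'a measure \<Rightarrow> ('a \<Rightarrow> real) \<Rightarrow> ('a \<Rightarrow> real) \<Rightarrow> nat \<Rightarrow> real \<Rightarrow> real" where
  "mEFN_opt \<pi>1 M f0 f1 n \<alpha> =
     Inf {EFN \<pi>1 M f0 f1 n K |K. decision_rule M n K \<and> mFDR \<pi>1 M f0 f1 n K \<le> \<alpha>}"

text \<open>For \<open>h\<close> bounded below on \<open>[0,1]\<close> and \<open>x \<in> [0,1]\<close> the set of values is nonempty and bounded
  above by \<open>h x\<close>.\<close>

definition greatest_convex_minorant :: "(real \<Rightarrow> real) \<Rightarrow> real \<Rightarrow> real" where
  "greatest_convex_minorant h x =
     Sup {C x |C. convex_on {0..1} C \<and> (\<forall>y\<in>{0..1}. C y \<le> h y)}"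

end

theory Submission
  imports Defs
begin

text \<open>
  Given the data, the labels are independent Bernoulli with parameters \<open>eta (x i)\<close>, so all error rates
  are expectations over the observations and decisions only.

  Upper bound: a rule for \<open>m\<close> hypotheses yields a test for a single one, and this test applied
  independently to \<open>n\<close> hypotheses has the same mFDR and EFN, and an FDR that is no larger. Randomizing
  between two rules makes FDR and EFN affine. Hence for every \<open>n\<close> the optimal EFN under FDR control is a
  convex function of the level lying below the optimal EFN under mFDR control.

  Lower bound: let \<open>c - s * \<alpha>\<close> be a supporting line of a convex minorant. For a fixed sample, the decisions
  can be imitated, after sorting the hypotheses into finitely many bins by their posterior probability,
  by a test for one hypothesis, up to the deviation of the empirical bin frequencies from their
  expectations. So the line also bounds, up to that error, the false negatives of the sample in terms of
  its false discovery proportion. As the bound is linear, it can be integrated.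
\<close>

section \<open>Product measures\<close>

text \<open>The false discovery proportion is a quotient, unstable when few hypotheses are rejected.
  But then few non-nulls are found, so the bound wanted for the true rejections is trivial up to
  \<epsilon>; with more than \<open>\<epsilon> * n\<close> rejections, an error in the numerator is
  magnified by at most \<open>1 / \<epsilon>\<close>. This is the origin of the factor
  \<open>1 + s / \<epsilon>\<close> in the lower bound. Two one-sided comparisons between a sample
  and the test imitating it suffice: the test rejects with probability at most the proportion of
  rejections in the sample, and it finds almost as many non-nulls. Both hold for every sample and
  every decision vector, so the rule producing the decisions may be arbitrary, and no description of
  an optimal rule enters. Although the labels are independent given the data, only the posterior of
  each single label is used: once the decisions are fixed, all quantities integrated are linear in
  the labels.\<close>

lemma binary_space_eq: "binary_space n = count_space (PiE {..<n} (\<lambda>_. UNIV))"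
  unfolding binary_space_def by (rule count_space_PiM_finite) auto

text \<open>Drawing coordinate \<open>i\<close> afresh from \<open>N i\<close> leaves the product
  law unchanged. Phrased with an update, the index set remains \<open>I\<close> and is never split
  into \<open>i\<close> and the rest.\<close>

lemma integral_PiM_resample:
  fixes F :: "('i \<Rightarrow> 'a) \<Rightarrow> real"
  assumes N: "\<And>i. i \<in> I \<Longrightarrow> prob_space (N i)" and i: "i \<in> I"
    and F: "integrable (PiM I N) F"
  shows "(\<integral>x. F x \<partial>PiM I N) = (\<integral>z. (\<integral>x. F (x(i := z)) \<partial>PiM I N) \<partial>N i)"
proof -
  interpret Ni: prob_space "N i" using N i by blast
  interpret P: prob_space "PiM I N" by (rule prob_space_PiM) (rule N)
  interpret pair_sigma_finite "N i" "PiM I N" ..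
  have ins: "insert i I = I" using i by auto
  have eq: "distr (N i \<Otimes>\<^sub>M PiM I N) (PiM I N) (\<lambda>(z, x). x(i := z)) = PiM I N"
    using distr_pair_PiM_eq_PiM[of I N i] N i by (simp add: ins)
  have [measurable]: "(\<lambda>(z, x). x(i := z)) \<in> N i \<Otimes>\<^sub>M PiM I N \<rightarrow>\<^sub>M PiM I N"
  proof -
    have "(\<lambda>p. (snd p)(i := fst p)) \<in> N i \<Otimes>\<^sub>M PiM I N \<rightarrow>\<^sub>M PiM (insert i I) N"
      by (intro measurable_fun_upd[where J = I]) auto
    then show ?thesis by (simp add: ins case_prod_beta')
  qed
  have [measurable]: "F \<in> borel_measurable (PiM I N)" using F by auto
  have int: "integrable (N i \<Otimes>\<^sub>M PiM I N) (\<lambda>(z, x). F (x(i := z)))"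
    using integrable_distr[of "\<lambda>(z, x). x(i := z)" "N i \<Otimes>\<^sub>M PiM I N" "PiM I N" F] F eq
    by (simp add: case_prod_beta')
  have "(\<integral>x. F x \<partial>PiM I N) = (\<integral>x. F x \<partial>distr (N i \<Otimes>\<^sub>M PiM I N) (PiM I N) (\<lambda>(z, x). x(i := z)))"
    by (simp add: eq)
  also have "\<dots> = (\<integral>p. F ((\<lambda>(z, x). x(i := z)) p) \<partial>(N i \<Otimes>\<^sub>M PiM I N))"
    by (rule integral_distr) auto
  also have "\<dots> = (\<integral>(z, x). F (x(i := z)) \<partial>(N i \<Otimes>\<^sub>M PiM I N))"
    by (simp add: case_prod_beta')
  also have "\<dots> = (\<integral>z. (\<integral>x. F (x(i := z)) \<partial>PiM I N) \<partial>N i)"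
    using integral_fst[OF int] by simp
  finally show ?thesis .
qed

text \<open>Independence of one coordinate from a function of the others. That \<open>c\<close>
  depends on the others only is expressed by its invariance under updates at
  \<open>i\<close>.\<close>

lemma integral_PiM_mult_coordinate:
  fixes c :: "('i \<Rightarrow> 'a) \<Rightarrow> real" and g :: "'a \<Rightarrow> real"
  assumes N: "\<And>i. i \<in> I \<Longrightarrow> prob_space (N i)" and i: "i \<in> I"
    and F: "integrable (PiM I N) (\<lambda>x. g (x i) * c x)"
    and c: "\<And>x z. x \<in> space (PiM I N) \<Longrightarrow> z \<in> space (N i) \<Longrightarrow> c (x(i := z)) = c x"
  shows "(\<integral>x. g (x i) * c x \<partial>PiM I N) = (\<integral>z. g z \<partial>N i) * (\<integral>x. c x \<partial>PiM I N)"
proof -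
  have "(\<integral>x. g (x i) * c x \<partial>PiM I N) =
      (\<integral>z. (\<integral>x. g ((x(i := z)) i) * c (x(i := z)) \<partial>PiM I N) \<partial>N i)"
    by (rule integral_PiM_resample[OF N i F])
  also have "\<dots> = (\<integral>z. g z * (\<integral>x. c x \<partial>PiM I N) \<partial>N i)"
    by (intro Bochner_Integration.integral_cong refl)
       (simp add: c cong: Bochner_Integration.integral_cong)
  finally show ?thesis by simp
qed

lemma integral_PiM_coordinate:
  fixes g :: "'a \<Rightarrow> real"
  assumes N: "\<And>i. i \<in> I \<Longrightarrow> prob_space (N i)" and i: "i \<in> I"
    and g: "g \<in> borel_measurable (N i)"
  shows "(\<integral>x. g (x i) \<partial>PiM I N) = (\<integral>z. g z \<partial>N i)"
proof -
  have "distr (PiM I N) (N i) (\<lambda>x. x i) = N i"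
    by (rule distr_PiM_component) (use N i in auto)
  then have "(\<integral>z. g z \<partial>N i) = (\<integral>z. g z \<partial>distr (PiM I N) (N i) (\<lambda>x. x i))" by simp
  also have "\<dots> = (\<integral>x. g (x i) \<partial>PiM I N)"
    by (rule integral_distr) (use g i in auto)
  finally show ?thesis ..
qed

lemma PiM_density:
  assumes I: "finite I" and N: "\<And>i. prob_space (N i)"
    and h: "\<And>i. i \<in> I \<Longrightarrow> h i \<in> borel_measurable (N i)"
    and D: "\<And>i. i \<in> I \<Longrightarrow> sigma_finite_measure (density (N i) (h i))"
  shows "(\<Pi>\<^sub>M i\<in>I. density (N i) (h i)) = density (PiM I N) (\<lambda>x. \<Prod>i\<in>I. h i (x i))"
proof -
  \<comment> \<open>The locale of sigma-finite families quantifies over all indices; outside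
    \<open>I\<close> the density 1 reduces the measure to \<open>N i\<close>.\<close>
  define h' where "h' i = (if i \<in> I then h i else (\<lambda>_. 1))" for i
  have sf: "sigma_finite_measure (density (N i) (h' i))" for i
    using D[of i] N[of i] prob_space_imp_sigma_finite
    by (cases "i \<in> I") (auto simp: h'_def density_1)
  interpret Dn: product_sigma_finite "\<lambda>i. density (N i) (h' i)"
    by (rule product_sigma_finite.intro) (rule sf)
  interpret Nn: product_sigma_finite N
    by (rule product_sigma_finite.intro) (rule prob_space_imp_sigma_finite[OF N])
  have [measurable]: "\<And>i. i \<in> I \<Longrightarrow> h i \<in> borel_measurable (N i)" by (rule h)
  have "density (PiM I N) (\<lambda>x. \<Prod>i\<in>I. h i (x i)) = (\<Pi>\<^sub>M i\<in>I. density (N i) (h' i))"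
  proof (rule Dn.PiM_eqI[OF I])
    show "sets (density (PiM I N) (\<lambda>x. \<Prod>i\<in>I. h i (x i))) = sets (PiM I (\<lambda>i. density (N i) (h' i)))"
      by (simp cong: sets_PiM_cong)
  next
    fix A assume A': "\<And>i. i \<in> I \<Longrightarrow> A i \<in> sets (density (N i) (h' i))"
    then have A[measurable]: "\<And>i. i \<in> I \<Longrightarrow> A i \<in> sets (N i)" by simp
    have [measurable]: "Pi\<^sub>E I A \<in> sets (PiM I N)" using A I by (auto intro: sets_PiM_I_finite)
    have "emeasure (density (PiM I N) (\<lambda>x. \<Prod>i\<in>I. h i (x i))) (Pi\<^sub>E I A) =
        (\<integral>\<^sup>+x. (\<Prod>i\<in>I. h i (x i)) * indicator (Pi\<^sub>E I A) x \<partial>PiM I N)"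
      using I by (intro emeasure_density) measurable
    also have "\<dots> = (\<integral>\<^sup>+x. (\<Prod>i\<in>I. h i (x i) * indicator (A i) (x i)) \<partial>PiM I N)"
    proof (rule nn_integral_cong)
      fix x assume "x \<in> space (PiM I N)"
      then have "indicator (Pi\<^sub>E I A) x = (\<Prod>i\<in>I. indicator (A i) (x i) :: ennreal)"
        using I by (auto simp: indicator_def space_PiM PiE_iff)
      then show "(\<Prod>i\<in>I. h i (x i)) * indicator (Pi\<^sub>E I A) x =
          (\<Prod>i\<in>I. h i (x i) * indicator (A i) (x i))"
        by (simp add: prod.distrib)
    qed
    also have "\<dots> = (\<Prod>i\<in>I. \<integral>\<^sup>+z. h i z * indicator (A i) z \<partial>N i)"
      by (rule Nn.product_nn_integral_prod) (use I in auto)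
    also have "\<dots> = (\<Prod>i\<in>I. emeasure (density (N i) (h' i)) (A i))"
      by (intro prod.cong refl) (simp add: emeasure_density h'_def)
    finally show "emeasure (density (PiM I N) (\<lambda>x. \<Prod>i\<in>I. h i (x i))) (Pi\<^sub>E I A) =
        (\<Prod>i\<in>I. emeasure (density (N i) (h' i)) (A i))" .
  qed
  also have "\<dots> = (\<Pi>\<^sub>M i\<in>I. density (N i) (h i))"
    by (intro PiM_cong) (auto simp: h'_def)
  finally show ?thesis ..
qed

section \<open>Reduction to the posterior probabilities\<close>

locale two_group =
  fixes \<pi>1 :: real and M :: "'a measure" and f0 f1 :: "'a \<Rightarrow> real"
  assumes pi1: "0 < \<pi>1" "\<pi>1 < 1"
    and f0: "prob_density M f0" and f1: "prob_density M f1"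
begin

definition mix :: "'a \<Rightarrow> real" where "mix x = (1 - \<pi>1) * f0 x + \<pi>1 * f1 x"

definition mu :: "'a measure" where "mu = density M (\<lambda>x. ennreal (mix x))"

text \<open>The posterior probability of a non-null. The value where \<open>mix\<close> vanishes makes both ratios below
  equal to 1; the truncation only matters outside the sample space.\<close>

definition eta :: "'a \<Rightarrow> real" where "eta x = (if mix x \<le> 0 then \<pi>1 else min 1 (max 0 (\<pi>1 * f1 x / mix x)))"

text \<open>By Bayes' rule this is the density of an observation with label \<open>t\<close>
  relative to the mixture. Written through \<open>eta\<close>, it leaves \<open>eta\<close> as the
  only feature of an observation on which the later formulas depend.\<close>

definition ratio :: "bool \<Rightarrow> 'a \<Rightarrow> real" where
  "ratio t x = (if t then eta x / \<pi>1 else (1 - eta x) / (1 - \<pi>1))"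

definition post :: "bool \<Rightarrow> 'a \<Rightarrow> real" where
  "post t x = (if t then eta x else 1 - eta x)"

lemma measurable_densities [measurable]: "f0 \<in> borel_measurable M" "f1 \<in> borel_measurable M"
  using f0 f1 by (auto simp: prob_density_def)

lemma densities_nonneg: "x \<in> space M \<Longrightarrow> 0 \<le> f0 x" "x \<in> space M \<Longrightarrow> 0 \<le> f1 x"
  using f0 f1 by (auto simp: prob_density_def)

lemma measurable_mix [measurable]: "mix \<in> borel_measurable M"
  unfolding mix_def by measurable

lemma measurable_eta_M: "eta \<in> borel_measurable M"
  unfolding eta_def by measurable

lemma sets_mu [measurable_cong, simp]: "sets mu = sets M"
  by (simp add: mu_def)

lemma space_mu [simp]: "space mu = space M"
  by (simp add: mu_def)

lemma measurable_eta [measurable]: "eta \<in> borel_measurable mu"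
  using measurable_eta_M by (simp cong: measurable_cong_sets)

lemma eta_bounds: "0 \<le> eta x" "eta x \<le> 1"
  using pi1 by (auto simp: eta_def)

lemma measurable_ratio [measurable]: "ratio t \<in> borel_measurable mu"
  unfolding ratio_def by measurable

lemma measurable_post [measurable]: "post t \<in> borel_measurable mu"
  unfolding post_def by measurable

lemma post_bounds: "0 \<le> post t x" "post t x \<le> 1"
  using eta_bounds[of x] by (auto simp: post_def)

lemma ratio_nonneg: "0 \<le> ratio t x"
  using eta_bounds[of x] pi1 by (auto simp: ratio_def)

text \<open>Both prior weights are positive, so both densities vanish wherever \<open>mix\<close>
  does. Hence the identity holds at every point of the space and not just almost everywhere.\<close>

lemma ratio_eq_density:
  assumes "x \<in> space M"
  shows "mix x * ratio t x = (if t then f1 x else f0 x)"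
proof -
  have f: "0 \<le> f0 x" "0 \<le> f1 x" using densities_nonneg assms by auto
  have m: "mix x \<ge> 0" "(1 - \<pi>1) * f0 x \<le> mix x" "\<pi>1 * f1 x \<le> mix x"
    using f pi1 by (auto simp: mix_def)
  show ?thesis
  proof (cases "mix x \<le> 0")
    case True
    then have "(1 - \<pi>1) * f0 x \<le> 0" "\<pi>1 * f1 x \<le> 0" using m by linarith+
    then have "f0 x = 0" "f1 x = 0" using f pi1 by (auto simp: mult_le_0_iff)
    then show ?thesis by (simp add: mix_def)
  next
    case False
    then have "mix x > 0" by simp
    then have "eta x = \<pi>1 * f1 x / mix x" using m f pi1 by (auto simp: eta_def min_def max_def)
    moreover have "1 - \<pi>1 * f1 x / mix x = (1 - \<pi>1) * f0 x / mix x"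
      using \<open>mix x > 0\<close> by (simp add: field_simps mix_def)
    ultimately show ?thesis using \<open>mix x > 0\<close> pi1 by (simp add: ratio_def)
  qed
qed

lemma prob_space_mu: "prob_space mu"
proof
  have "emeasure mu (space mu) = (\<integral>\<^sup>+x. ennreal (mix x) \<partial>M)"
    by (simp add: mu_def emeasure_density cong: nn_integral_cong)
  also have "\<dots> = (\<integral>\<^sup>+x. ennreal (1 - \<pi>1) * ennreal (f0 x) + ennreal \<pi>1 * ennreal (f1 x) \<partial>M)"
    using pi1 densities_nonneg
    by (intro nn_integral_cong) (simp add: mix_def ennreal_mult[symmetric] flip: ennreal_plus)
  also have "\<dots> = ennreal (1 - \<pi>1) * (\<integral>\<^sup>+x. ennreal (f0 x) \<partial>M) + ennreal \<pi>1 * (\<integral>\<^sup>+x. ennreal (f1 x) \<partial>M)"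
    by (subst nn_integral_add) (auto simp: nn_integral_cmult)
  also have "\<dots> = 1"
    using f0 f1 pi1 by (simp add: prob_density_def flip: ennreal_plus)
  finally show "emeasure mu (space mu) = 1" .
qed

sublocale mu: prob_space mu by (rule prob_space_mu)

text \<open>\<open>M\<close> may fail to be sigma-finite, so of its powers only the sigma-algebra is
  used. The probability measure \<open>mu\<close> dominates both component laws, and the laws of
  samples get densities over powers of \<open>mu\<close>.\<close>

lemma density_label_eq:
  "density M (\<lambda>x. ennreal (if t then f1 x else f0 x)) = density mu (\<lambda>x. ennreal (ratio t x))"
proof -
  have [measurable]: "ratio t \<in> borel_measurable M"
    using measurable_ratio[of t] by (simp cong: measurable_cong_sets)
  have "density mu (\<lambda>x. ennreal (ratio t x)) = density M (\<lambda>x. ennreal (mix x) * ennreal (ratio t x))"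
    unfolding mu_def by (rule density_density_eq) auto
  also have "\<dots> = density M (\<lambda>x. ennreal (if t then f1 x else f0 x))"
    by (intro density_cong AE_I2)
      (use densities_nonneg in \<open>auto simp: ratio_nonneg ratio_eq_density simp flip: ennreal_mult''\<close>)
  finally show ?thesis ..
qed

lemma prob_space_label_density: "prob_space (density M (\<lambda>x. ennreal (if t then f1 x else f0 x)))"
proof
  have "(\<integral>\<^sup>+x. ennreal (if t then f1 x else f0 x) \<partial>M) = 1"
    using f0 f1 by (cases t) (auto simp: prob_density_def)
  then show "emeasure (density M (\<lambda>x. ennreal (if t then f1 x else f0 x)))
      (space (density M (\<lambda>x. ennreal (if t then f1 x else f0 x)))) = 1"
    by (simp add: emeasure_density cong: nn_integral_cong)
qed

abbreviation P :: "nat \<Rightarrow> (nat \<Rightarrow> 'a) measure" where "P n \<equiv> \<Pi>\<^sub>M i\<in>{..<n}. mu"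

lemma sets_P [measurable_cong, simp]: "sets (P n) = sets (obs_space M n)"
  unfolding obs_space_def by (rule sets_PiM_cong) auto

lemma prob_space_P: "prob_space (P n)"
  by (rule prob_space_PiM) (rule prob_space_mu)

lemma prob_space_obs_law: "prob_space (obs_law M f0 f1 n \<theta>)"
  unfolding obs_law_def by (rule prob_space_PiM) (rule prob_space_label_density)

lemma sets_obs_law [measurable_cong, simp]: "sets (obs_law M f0 f1 n \<theta>) = sets (obs_space M n)"
  unfolding obs_law_def obs_space_def by (rule sets_PiM_cong) auto

lemma obs_law_eq_density:
  "obs_law M f0 f1 n \<theta> = density (P n) (\<lambda>x. \<Prod>i<n. ennreal (ratio (\<theta> i) (x i)))"
  unfolding obs_law_def density_label_eq
  by (rule PiM_density)
    (use prob_space_mu prob_space_label_density in \<open>auto simp flip: density_label_eq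
      intro: prob_space_imp_sigma_finite\<close>)

lemma prob_space_label_law: "prob_space (label_law \<pi>1 n)"
  unfolding label_law_def by (rule prob_space_PiM) (rule measure_pmf.prob_space_axioms)

lemma sets_label_law [measurable_cong, simp]: "sets (label_law \<pi>1 n) = sets (binary_space n)"
  unfolding label_law_def binary_space_def by (rule sets_PiM_cong) auto

text \<open>Averaged over the labels, the observations are iid with law \<open>mu\<close>, so this is the marginal
  of \<open>joint_law\<close> on observations and decisions.\<close>

definition Q :: "nat \<Rightarrow> ((nat \<Rightarrow> 'a) \<Rightarrow> (nat \<Rightarrow> bool) measure) \<Rightarrow> ((nat \<Rightarrow> 'a) \<times> (nat \<Rightarrow> bool)) measure" where
  "Q n K = P n \<bind> (\<lambda>x. K x \<bind> (\<lambda>\<delta>. return (obs_space M n \<Otimes>\<^sub>M binary_space n) (x, \<delta>)))"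

lemma P_in_prob_algebra: "P n \<in> space (prob_algebra (obs_space M n))"
  by (simp add: space_prob_algebra prob_space_P)

lemma Q_kernel:
  assumes K: "decision_rule M n K"
  shows "(\<lambda>x. K x \<bind> (\<lambda>\<delta>. return (obs_space M n \<Otimes>\<^sub>M binary_space n) (x, \<delta>)))
    \<in> obs_space M n \<rightarrow>\<^sub>M prob_algebra (obs_space M n \<Otimes>\<^sub>M binary_space n)"
proof -
  have [measurable]: "K \<in> obs_space M n \<rightarrow>\<^sub>M prob_algebra (binary_space n)"
    using K by (simp add: decision_rule_def)
  show ?thesis by measurable
qed

lemma decision_ruleD:
  assumes "decision_rule M n K" and "x \<in> space (obs_space M n)"
  shows "prob_space (K x)" "sets (K x) = sets (binary_space n)" "space (K x) = space (binary_space n)"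
proof -
  have "K x \<in> space (prob_algebra (binary_space n))"
    using assms measurable_space[of K "obs_space M n" "prob_algebra (binary_space n)" x]
    by (simp add: decision_rule_def)
  then show "prob_space (K x)" and s: "sets (K x) = sets (binary_space n)"
    by (auto simp: space_prob_algebra)
  show "space (K x) = space (binary_space n)" by (rule sets_eq_imp_space_eq[OF s])
qed

lemma prob_space_Q: "decision_rule M n K \<Longrightarrow> prob_space (Q n K)"
  unfolding Q_def by (rule prob_space_bind'[OF P_in_prob_algebra Q_kernel])

lemma sets_Q: "decision_rule M n K \<Longrightarrow> sets (Q n K) = sets (obs_space M n \<Otimes>\<^sub>M binary_space n)"
  unfolding Q_def by (rule sets_bind'[OF P_in_prob_algebra Q_kernel])

lemma nn_integral_Q:
  assumes K: "decision_rule M n K"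
    and F[measurable]: "F \<in> borel_measurable (obs_space M n \<Otimes>\<^sub>M binary_space n)"
  shows "(\<integral>\<^sup>+p. F p \<partial>Q n K) = (\<integral>\<^sup>+x. \<integral>\<^sup>+\<delta>. F (x, \<delta>) \<partial>K x \<partial>P n)"
proof -
  have [measurable]: "K \<in> obs_space M n \<rightarrow>\<^sub>M prob_algebra (binary_space n)"
    using K by (simp add: decision_rule_def)
  have "(\<integral>\<^sup>+p. F p \<partial>Q n K) = (\<integral>\<^sup>+x. (\<integral>\<^sup>+p. F p \<partial>(K x \<bind> (\<lambda>\<delta>. return (obs_space M n \<Otimes>\<^sub>M binary_space n) (x, \<delta>)))) \<partial>P n)"
    unfolding Q_def
    by (rule nn_integral_bind[OF F]) (use measurable_prob_algebraD[OF Q_kernel[OF K]] in \<open>simp cong: measurable_cong_sets\<close>)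
  also have "\<dots> = (\<integral>\<^sup>+x. \<integral>\<^sup>+\<delta>. F (x, \<delta>) \<partial>K x \<partial>P n)"
  proof (rule nn_integral_cong)
    fix x assume "x \<in> space (P n)"
    then have x: "x \<in> space (obs_space M n)" by (simp add: sets_eq_imp_space_eq[OF sets_P])
    have [measurable_cong]: "sets (K x) = sets (binary_space n)" by (rule decision_ruleD[OF K x])
    have sp: "space (K x) = space (binary_space n)" by (rule decision_ruleD[OF K x])
    have "(\<integral>\<^sup>+p. F p \<partial>(K x \<bind> (\<lambda>\<delta>. return (obs_space M n \<Otimes>\<^sub>M binary_space n) (x, \<delta>)))) =
        (\<integral>\<^sup>+\<delta>. \<integral>\<^sup>+p. F p \<partial>return (obs_space M n \<Otimes>\<^sub>M binary_space n) (x, \<delta>) \<partial>K x)"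
      using x by (intro nn_integral_bind[OF F] measurable_prob_algebraD) measurable
    also have "\<dots> = (\<integral>\<^sup>+\<delta>. F (x, \<delta>) \<partial>K x)"
      by (intro nn_integral_cong nn_integral_return) (use x sp in \<open>auto simp: space_pair_measure\<close>)
    finally show "(\<integral>\<^sup>+p. F p \<partial>(K x \<bind> (\<lambda>\<delta>. return (obs_space M n \<Otimes>\<^sub>M binary_space n) (x, \<delta>)))) =
        (\<integral>\<^sup>+\<delta>. F (x, \<delta>) \<partial>K x)" .
  qed
  finally show ?thesis .
qed

lemma measurable_nn_kernel [measurable]:
  assumes K: "decision_rule M n K"
    and [measurable]: "F \<in> borel_measurable (obs_space M n \<Otimes>\<^sub>M binary_space n)"
  shows "(\<lambda>x. \<integral>\<^sup>+\<delta>. F (x, \<delta>) \<partial>K x) \<in> borel_measurable (obs_space M n)"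
proof -
  have [measurable]: "K \<in> obs_space M n \<rightarrow>\<^sub>M subprob_algebra (binary_space n)"
    using K by (simp add: decision_rule_def measurable_prob_algebraD)
  show ?thesis
    by (rule nn_integral_measurable_subprob_algebra2[where N = "binary_space n"]) auto
qed

text \<open>The label space is finite and discrete, so every family of probability laws indexed by
  it is a kernel.\<close>

lemma obs_law_kernel:
  "obs_law M f0 f1 n \<in> binary_space n \<rightarrow>\<^sub>M prob_algebra (obs_space M n)"
  unfolding binary_space_eq
  by (auto simp: measurable_def space_prob_algebra prob_space_obs_law)

lemma label_law_in_prob_algebra: "label_law \<pi>1 n \<in> space (prob_algebra (binary_space n))"
  by (simp add: space_prob_algebra prob_space_label_law)

abbreviation joint_space :: "nat \<Rightarrow> ((nat \<Rightarrow> bool) \<times> (nat \<Rightarrow> 'a) \<times> (nat \<Rightarrow> bool)) measure" where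
  "joint_space n \<equiv> binary_space n \<Otimes>\<^sub>M obs_space M n \<Otimes>\<^sub>M binary_space n"

text \<open>The first form is measurable jointly in labels and observations; freezing the labels in
  it yields the inner kernel needed to unfold \<open>joint_law\<close>.\<close>

lemma joint_kernels:
  assumes K: "decision_rule M n K"
  shows "(\<lambda>p. K (snd p) \<bind> (\<lambda>\<delta>. return (joint_space n) (fst p, snd p, \<delta>)))
      \<in> binary_space n \<Otimes>\<^sub>M obs_space M n \<rightarrow>\<^sub>M prob_algebra (joint_space n)" (is ?A)
    and "(\<lambda>\<theta>. obs_law M f0 f1 n \<theta> \<bind> (\<lambda>x. K x \<bind> (\<lambda>\<delta>. return (joint_space n) (\<theta>, x, \<delta>))))
      \<in> binary_space n \<rightarrow>\<^sub>M prob_algebra (joint_space n)" (is ?B)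
proof -
  have [measurable]: "K \<in> obs_space M n \<rightarrow>\<^sub>M prob_algebra (binary_space n)"
    using K by (simp add: decision_rule_def)
  note [measurable] = obs_law_kernel
  show ?A ?B by measurable
qed

lemma prob_space_joint_law:
  assumes "decision_rule M n K"
  shows "prob_space (joint_law \<pi>1 M f0 f1 n K)"
  unfolding joint_law_def
  by (rule prob_space_bind'[OF label_law_in_prob_algebra joint_kernels(2)[OF assms]])

lemma sets_joint_law:
  assumes "decision_rule M n K"
  shows "sets (joint_law \<pi>1 M f0 f1 n K) = sets (joint_space n)"
  unfolding joint_law_def
  by (rule sets_bind'[OF label_law_in_prob_algebra joint_kernels(2)[OF assms]])

lemma nn_integral_joint_law:
  assumes K: "decision_rule M n K"
    and F[measurable]: "F \<in> borel_measurable (joint_space n)"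
  shows "(\<integral>\<^sup>+p. F p \<partial>joint_law \<pi>1 M f0 f1 n K) =
    (\<integral>\<^sup>+\<theta>. \<integral>\<^sup>+x. \<integral>\<^sup>+\<delta>. F (\<theta>, x, \<delta>) \<partial>K x \<partial>obs_law M f0 f1 n \<theta> \<partial>label_law \<pi>1 n)"
proof -
  have [measurable]: "K \<in> obs_space M n \<rightarrow>\<^sub>M prob_algebra (binary_space n)"
    using K by (simp add: decision_rule_def)
  have "(\<integral>\<^sup>+p. F p \<partial>joint_law \<pi>1 M f0 f1 n K) =
    (\<integral>\<^sup>+\<theta>. (\<integral>\<^sup>+p. F p \<partial>(obs_law M f0 f1 n \<theta> \<bind>
        (\<lambda>x. K x \<bind> (\<lambda>\<delta>. return (joint_space n) (\<theta>, x, \<delta>))))) \<partial>label_law \<pi>1 n)"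
    unfolding joint_law_def
    by (rule nn_integral_bind[OF F])
      (use measurable_prob_algebraD[OF joint_kernels(2)[OF K]] in \<open>simp cong: measurable_cong_sets\<close>)
  also have "\<dots> = (\<integral>\<^sup>+\<theta>. \<integral>\<^sup>+x. \<integral>\<^sup>+\<delta>. F (\<theta>, x, \<delta>) \<partial>K x \<partial>obs_law M f0 f1 n \<theta> \<partial>label_law \<pi>1 n)"
  proof (rule nn_integral_cong)
    fix \<theta> assume "\<theta> \<in> space (label_law \<pi>1 n)"
    then have th: "\<theta> \<in> space (binary_space n)" by (simp add: sets_eq_imp_space_eq[OF sets_label_law])
    have ker: "(\<lambda>x. K x \<bind> (\<lambda>\<delta>. return (joint_space n) (\<theta>, x, \<delta>)))
      \<in> obs_space M n \<rightarrow>\<^sub>M subprob_algebra (joint_space n)"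
      using measurable_compose[OF measurable_Pair1'[OF th] measurable_prob_algebraD[OF joint_kernels(1)[OF K]]]
      by simp
    have "(\<integral>\<^sup>+p. F p \<partial>(obs_law M f0 f1 n \<theta> \<bind> (\<lambda>x. K x \<bind> (\<lambda>\<delta>. return (joint_space n) (\<theta>, x, \<delta>))))) =
      (\<integral>\<^sup>+x. (\<integral>\<^sup>+p. F p \<partial>(K x \<bind> (\<lambda>\<delta>. return (joint_space n) (\<theta>, x, \<delta>)))) \<partial>obs_law M f0 f1 n \<theta>)"
      by (rule nn_integral_bind[OF F]) (use ker in \<open>simp cong: measurable_cong_sets\<close>)
    also have "\<dots> = (\<integral>\<^sup>+x. \<integral>\<^sup>+\<delta>. F (\<theta>, x, \<delta>) \<partial>K x \<partial>obs_law M f0 f1 n \<theta>)"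
    proof (rule nn_integral_cong)
      fix x assume "x \<in> space (obs_law M f0 f1 n \<theta>)"
      then have x: "x \<in> space (obs_space M n)" by (simp add: sets_eq_imp_space_eq[OF sets_obs_law])
      have [measurable_cong]: "sets (K x) = sets (binary_space n)" by (rule decision_ruleD[OF K x])
      have sp: "space (K x) = space (binary_space n)" by (rule decision_ruleD[OF K x])
      have "(\<integral>\<^sup>+p. F p \<partial>(K x \<bind> (\<lambda>\<delta>. return (joint_space n) (\<theta>, x, \<delta>)))) =
        (\<integral>\<^sup>+\<delta>. \<integral>\<^sup>+p. F p \<partial>return (joint_space n) (\<theta>, x, \<delta>) \<partial>K x)"
        using x th by (intro nn_integral_bind[OF F] measurable_prob_algebraD) measurable
      also have "\<dots> = (\<integral>\<^sup>+\<delta>. F (\<theta>, x, \<delta>) \<partial>K x)"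
        by (intro nn_integral_cong nn_integral_return) (use x th sp in \<open>auto simp: space_pair_measure\<close>)
      finally show "(\<integral>\<^sup>+p. F p \<partial>(K x \<bind> (\<lambda>\<delta>. return (joint_space n) (\<theta>, x, \<delta>)))) =
        (\<integral>\<^sup>+\<delta>. F (\<theta>, x, \<delta>) \<partial>K x)" .
    qed
    finally show "(\<integral>\<^sup>+p. F p \<partial>(obs_law M f0 f1 n \<theta> \<bind>
        (\<lambda>x. K x \<bind> (\<lambda>\<delta>. return (joint_space n) (\<theta>, x, \<delta>))))) =
      (\<integral>\<^sup>+x. \<integral>\<^sup>+\<delta>. F (\<theta>, x, \<delta>) \<partial>K x \<partial>obs_law M f0 f1 n \<theta>)" .
  qed
  finally show ?thesis .
qed

text \<open>The integrand factorizes over the hypotheses. A factor with \<open>j \<noteq> i\<close>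
  averages to \<open>eta (x j) + (1 - eta (x j)) = 1\<close>; the factor of \<open>i\<close> is
  prior times likelihood ratio, which is the posterior weight of \<open>t\<close>.\<close>

lemma label_integral:
  assumes i: "i < n"
  shows "(\<integral>\<^sup>+\<theta>. ennreal (of_bool (\<theta> i = t)) * (\<Prod>j<n. ennreal (ratio (\<theta> j) (x j))) \<partial>label_law \<pi>1 n)
    = ennreal (post t (x i))"
proof -
  interpret B: product_sigma_finite "\<lambda>i::nat. measure_pmf (bernoulli_pmf \<pi>1)"
    by (rule product_sigma_finite.intro) (rule measure_pmf.sigma_finite_measure_axioms)
  let ?h = "\<lambda>j b. ennreal (if j = i then of_bool (b = t) * ratio b (x j) else ratio b (x j))"
  have bern: "(\<integral>\<^sup>+b. f b \<partial>measure_pmf (bernoulli_pmf \<pi>1)) =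
      f True * ennreal \<pi>1 + f False * ennreal (1 - \<pi>1)" for f
    using pi1 by (subst nn_integral_measure_pmf_support[of UNIV]) (auto simp: UNIV_bool add.commute)
  have "(\<integral>\<^sup>+\<theta>. ennreal (of_bool (\<theta> i = t)) * (\<Prod>j<n. ennreal (ratio (\<theta> j) (x j))) \<partial>label_law \<pi>1 n)
      = (\<integral>\<^sup>+\<theta>. (\<Prod>j<n. ?h j (\<theta> j)) \<partial>label_law \<pi>1 n)"
  proof (rule nn_integral_cong)
    fix \<theta>
    show "ennreal (of_bool (\<theta> i = t)) * (\<Prod>j<n. ennreal (ratio (\<theta> j) (x j))) = (\<Prod>j<n. ?h j (\<theta> j))"
      using i by (subst (1 2) prod.remove[of _ i]) (auto simp: ratio_nonneg ennreal_mult mult.assoc intro!: prod.cong)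
  qed
  also have "\<dots> = (\<Prod>j<n. \<integral>\<^sup>+b. ?h j b \<partial>measure_pmf (bernoulli_pmf \<pi>1))"
    unfolding label_law_def by (rule B.product_nn_integral_prod) auto
  also have "\<dots> = (\<Prod>j<n. if j = i then ennreal (post t (x i)) else 1)"
  proof (rule prod.cong[OF refl])
    fix j
    have "ratio True (x j) * \<pi>1 = eta (x j)" "ratio False (x j) * (1 - \<pi>1) = 1 - eta (x j)"
      using pi1 by (auto simp: ratio_def)
    then show "(\<integral>\<^sup>+b. ?h j b \<partial>measure_pmf (bernoulli_pmf \<pi>1)) = (if j = i then ennreal (post t (x i)) else 1)"
      unfolding bern using pi1 eta_bounds[of "x j"]
      by (cases t) (auto simp: post_def ratio_nonneg simp flip: ennreal_mult ennreal_plus)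
  qed
  also have "\<dots> = ennreal (post t (x i))"
    using i by (simp add: prod.delta)
  finally show ?thesis .
qed

text \<open>Bayes' formula. The kernel does not see the labels, so after passing to densities over
  \<open>P n\<close> the integral over the labels can be taken innermost, at fixed data, where it
  turns the indicator of the label into \<open>post\<close>.\<close>

lemma nn_integral_label_given_data:
  assumes K: "decision_rule M n K" and i: "i < n"
    and F[measurable]: "F \<in> borel_measurable (obs_space M n \<Otimes>\<^sub>M binary_space n)"
  shows "(\<integral>\<^sup>+(\<theta>, p). ennreal (of_bool (\<theta> i = t)) * F p \<partial>joint_law \<pi>1 M f0 f1 n K) =
    (\<integral>\<^sup>+(x, \<delta>). ennreal (post t (x i)) * F (x, \<delta>) \<partial>Q n K)"
proof -
  interpret L: prob_space "label_law \<pi>1 n" by (rule prob_space_label_law)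
  interpret Pn: prob_space "P n" by (rule prob_space_P)
  interpret LP: pair_sigma_finite "label_law \<pi>1 n" "P n" ..
  have [measurable]: "(\<lambda>x. x i) \<in> obs_space M n \<rightarrow>\<^sub>M M" if "i < n" for i
    unfolding obs_space_def using that by (intro measurable_component_singleton) auto
  have [measurable]: "(\<lambda>x. x i) \<in> binary_space n \<rightarrow>\<^sub>M count_space UNIV" if "i < n" for i
    unfolding binary_space_def using that by (intro measurable_component_singleton) auto
  have [measurable]: "(\<lambda>x. ratio t (x i)) \<in> borel_measurable (obs_space M n)" if "i < n" for i t
    by (rule measurable_compose[where N = mu]) (use that in auto)
  have [measurable]: "(\<lambda>x. post t (x i)) \<in> borel_measurable (obs_space M n)" if "i < n" for i t
    by (rule measurable_compose[where N = mu]) (use that in auto)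
  have [measurable]: "(\<lambda>p. \<Prod>j<n. ennreal (ratio (fst p j) (snd p j)))
      \<in> borel_measurable (binary_space n \<Otimes>\<^sub>M obs_space M n)"
  proof (intro borel_measurable_prod_ennreal)
    fix j assume "j \<in> {..<n}"
    then have [simp]: "j < n" by simp
    have "(\<lambda>p. ennreal (if fst p j then ratio True (snd p j) else ratio False (snd p j)))
      \<in> borel_measurable (binary_space n \<Otimes>\<^sub>M obs_space M n)" by measurable
    also have "(\<lambda>p. ennreal (if fst p j then ratio True (snd p j) else ratio False (snd p j))) =
      (\<lambda>p. ennreal (ratio (fst p j) (snd p j)))" by (auto simp: fun_eq_iff)
    finally show "(\<lambda>p. ennreal (ratio (fst p j) (snd p j)))
      \<in> borel_measurable (binary_space n \<Otimes>\<^sub>M obs_space M n)" .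
  qed
  define G where "G x = (\<integral>\<^sup>+\<delta>. F (x, \<delta>) \<partial>K x)" for x
  have [measurable]: "G \<in> borel_measurable (obs_space M n)"
    unfolding G_def by (rule measurable_nn_kernel[OF K F])
  have FK: "(\<lambda>\<delta>. F (x, \<delta>)) \<in> borel_measurable (K x)" if x: "x \<in> space (obs_space M n)" for x
    using measurable_compose[OF measurable_Pair1'[OF x] F] decision_ruleD(2)[OF K x]
    by (simp cong: measurable_cong_sets)
  have "(\<integral>\<^sup>+(\<theta>, p). ennreal (of_bool (\<theta> i = t)) * F p \<partial>joint_law \<pi>1 M f0 f1 n K) =
    (\<integral>\<^sup>+\<theta>. \<integral>\<^sup>+x. \<integral>\<^sup>+\<delta>. ennreal (of_bool (\<theta> i = t)) * F (x, \<delta>) \<partial>K x \<partial>obs_law M f0 f1 n \<theta> \<partial>label_law \<pi>1 n)"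
    using i by (subst nn_integral_joint_law[OF K]) auto
  also have "\<dots> = (\<integral>\<^sup>+\<theta>. \<integral>\<^sup>+x. ennreal (of_bool (\<theta> i = t)) * G x \<partial>obs_law M f0 f1 n \<theta> \<partial>label_law \<pi>1 n)"
    unfolding G_def
    by (intro nn_integral_cong nn_integral_cmult FK) (simp add: sets_eq_imp_space_eq[OF sets_obs_law])
  also have "\<dots> = (\<integral>\<^sup>+\<theta>. \<integral>\<^sup>+x. (\<Prod>j<n. ennreal (ratio (\<theta> j) (x j))) * (ennreal (of_bool (\<theta> i = t)) * G x) \<partial>P n \<partial>label_law \<pi>1 n)"
    unfolding obs_law_eq_density by (intro nn_integral_cong nn_integral_density) auto
  also have "\<dots> = (\<integral>\<^sup>+x. \<integral>\<^sup>+\<theta>. (\<Prod>j<n. ennreal (ratio (\<theta> j) (x j))) * (ennreal (of_bool (\<theta> i = t)) * G x) \<partial>label_law \<pi>1 n \<partial>P n)"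
    using i by (intro LP.Fubini'[symmetric]) (auto simp: case_prod_beta')
  also have "\<dots> = (\<integral>\<^sup>+x. ennreal (post t (x i)) * G x \<partial>P n)"
  proof (rule nn_integral_cong)
    fix x assume "x \<in> space (P n)"
    then have x: "x \<in> space (obs_space M n)" by (simp add: sets_eq_imp_space_eq[OF sets_P])
    have [measurable]: "h \<in> borel_measurable (label_law \<pi>1 n)" for h :: "(nat \<Rightarrow> bool) \<Rightarrow> ennreal"
      unfolding measurable_cong_sets[OF sets_label_law refl] by (simp add: binary_space_eq)
    have "(\<integral>\<^sup>+\<theta>. (\<Prod>j<n. ennreal (ratio (\<theta> j) (x j))) * (ennreal (of_bool (\<theta> i = t)) * G x) \<partial>label_law \<pi>1 n) =
      (\<integral>\<^sup>+\<theta>. ennreal (of_bool (\<theta> i = t)) * (\<Prod>j<n. ennreal (ratio (\<theta> j) (x j))) \<partial>label_law \<pi>1 n) * G x"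
      by (subst nn_integral_multc[symmetric]) (auto intro!: nn_integral_cong simp: mult_ac)
    then show "(\<integral>\<^sup>+\<theta>. (\<Prod>j<n. ennreal (ratio (\<theta> j) (x j))) * (ennreal (of_bool (\<theta> i = t)) * G x) \<partial>label_law \<pi>1 n) =
      ennreal (post t (x i)) * G x"
      by (simp add: label_integral[OF i])
  qed
  also have "\<dots> = (\<integral>\<^sup>+x. \<integral>\<^sup>+\<delta>. ennreal (post t (x i)) * F (x, \<delta>) \<partial>K x \<partial>P n)"
    unfolding G_def
    by (intro nn_integral_cong nn_integral_cmult[symmetric] FK) (simp add: sets_eq_imp_space_eq[OF sets_P])
  also have "\<dots> = (\<integral>\<^sup>+(x, \<delta>). ennreal (post t (x i)) * F (x, \<delta>) \<partial>Q n K)"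
    using i by (subst nn_integral_Q[OF K]) auto
  finally show ?thesis .
qed

end

declare sum_mult_of_bool_eq [simp del] sum_of_bool_mult_eq [simp del] sum_of_bool_eq [simp del]

lemma measurable_obs_coordinate:
  "i < n \<Longrightarrow> (\<lambda>x. x i) \<in> obs_space M n \<rightarrow>\<^sub>M M"
  unfolding obs_space_def by (intro measurable_component_singleton) auto

lemma measurable_binary_coordinate [measurable]:
  "i < n \<Longrightarrow> (\<lambda>x. x i) \<in> binary_space n \<rightarrow>\<^sub>M count_space UNIV"
  unfolding binary_space_def by (intro measurable_component_singleton) auto

lemma measurable_from_binary_space:
  "(f :: (nat \<Rightarrow> bool) \<Rightarrow> 'b::topological_space) \<in> borel_measurable (binary_space n)"
  by (simp add: binary_space_eq)

lemma rejections_nonneg: "0 \<le> rejections n \<delta>"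
  by (simp add: rejections_def sum_nonneg)

section \<open>Error rates in terms of posterior probabilities\<close>

context two_group
begin

lemma measurable_eta_coordinate [measurable]:
  "i < n \<Longrightarrow> (\<lambda>x. eta (x i)) \<in> borel_measurable (obs_space M n)"
  by (rule measurable_compose[OF measurable_obs_coordinate measurable_eta_M])

lemma measurable_post_coordinate [measurable]:
  "i < n \<Longrightarrow> (\<lambda>x. post t (x i)) \<in> borel_measurable (obs_space M n)"
  unfolding post_def by measurable

text \<open>\<open>ratio True\<close> is the density of the law of a non-null observation, so it
  integrates to 1 and \<open>eta\<close> to \<open>\<pi>1\<close>.\<close>

lemma integral_eta: "(\<integral>x. eta x \<partial>mu) = \<pi>1"
proof -
  interpret D: prob_space "density mu (\<lambda>x. ennreal (ratio True x))"
    using prob_space_label_density[of True] unfolding density_label_eq .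
  have "(\<integral>\<^sup>+x. ennreal (ratio True x) \<partial>mu) =
      (\<integral>\<^sup>+x. ennreal (ratio True x) * indicator (space mu) x \<partial>mu)"
    by (intro nn_integral_cong) simp
  also have "\<dots> = 1"
    using D.emeasure_space_1 by (simp add: emeasure_density)
  finally have "(\<integral>\<^sup>+x. ennreal (ratio True x) \<partial>mu) = 1" .
  then have "(\<integral>x. ratio True x \<partial>mu) = 1"
    by (subst integral_eq_nn_integral) (auto simp: ratio_nonneg)
  then show ?thesis using pi1 by (simp add: ratio_def)
qed

lemma integrable_Q:
  fixes F :: "_ \<Rightarrow> real"
  assumes K: "decision_rule M n K"
    and F: "F \<in> borel_measurable (obs_space M n \<Otimes>\<^sub>M binary_space n)"
    and C: "\<And>p. \<bar>F p\<bar> \<le> C"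
  shows "integrable (Q n K) F"
proof -
  interpret Q: prob_space "Q n K" by (rule prob_space_Q[OF K])
  show ?thesis
    by (rule Q.integrable_const_bound[where B = C])
      (use C F in \<open>auto simp: measurable_cong_sets[OF sets_Q[OF K] refl]\<close>)
qed

lemma integrable_joint_law:
  fixes F :: "_ \<Rightarrow> real"
  assumes K: "decision_rule M n K"
    and F: "F \<in> borel_measurable (joint_space n)"
    and C: "\<And>p. \<bar>F p\<bar> \<le> C"
  shows "integrable (joint_law \<pi>1 M f0 f1 n K) F"
proof -
  interpret J: prob_space "joint_law \<pi>1 M f0 f1 n K" by (rule prob_space_joint_law[OF K])
  show ?thesis
    by (rule J.integrable_const_bound[where B = C])
      (use C F in \<open>auto simp: measurable_cong_sets[OF sets_joint_law[OF K] refl]\<close>)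
qed

lemma integrable_P:
  fixes F :: "_ \<Rightarrow> real"
  assumes F: "F \<in> borel_measurable (obs_space M n)"
    and C: "\<And>p. p \<in> space (obs_space M n) \<Longrightarrow> \<bar>F p\<bar> \<le> C"
  shows "integrable (P n) F"
proof -
  interpret P: prob_space "P n" by (rule prob_space_P)
  show ?thesis
    by (rule P.integrable_const_bound[where B = C])
      (use C F in \<open>auto simp: measurable_cong_sets[OF sets_P refl] sets_eq_imp_space_eq[OF sets_P]\<close>)
qed

lemma integrable_mu:
  fixes F :: "'a \<Rightarrow> real"
  assumes "F \<in> borel_measurable mu" and "\<And>x. x \<in> space M \<Longrightarrow> \<bar>F x\<bar> \<le> C"
  shows "integrable mu F"
  by (rule mu.integrable_const_bound[where B = C]) (use assms in auto)

lemma integral_label_given_data: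
  assumes K: "decision_rule M n K" and i: "i < n" and \<psi>: "\<And>\<delta>. 0 \<le> \<psi> \<delta>"
  shows "(\<integral>(\<theta>, x, \<delta>). of_bool (\<theta> i = t) * \<psi> \<delta> \<partial>joint_law \<pi>1 M f0 f1 n K) =
    (\<integral>(x, \<delta>). post t (x i) * \<psi> \<delta> \<partial>Q n K)"
proof -
  have [measurable]: "\<psi> \<in> borel_measurable (binary_space n)" by (rule measurable_from_binary_space)
  have "(\<lambda>(\<theta>, x, \<delta>). of_bool (\<theta> i = t) * \<psi> \<delta>) \<in> borel_measurable (joint_law \<pi>1 M f0 f1 n K)"
    unfolding measurable_cong_sets[OF sets_joint_law[OF K] refl] using i by measurable
  moreover have "(\<lambda>(x, \<delta>). post t (x i) * \<psi> \<delta>) \<in> borel_measurable (Q n K)"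
    unfolding measurable_cong_sets[OF sets_Q[OF K] refl] using i by measurable
  moreover have "(\<lambda>p. ennreal (\<psi> (snd p))) \<in> borel_measurable (obs_space M n \<Otimes>\<^sub>M binary_space n)"
    by measurable
  ultimately show ?thesis
    using nn_integral_label_given_data[OF K i, of "\<lambda>p. ennreal (\<psi> (snd p))" t] \<psi>
    by (simp add: integral_eq_nn_integral case_prod_beta' post_bounds ennreal_mult)
qed

text \<open>The expected number of rejected non-nulls, each label being replaced by its posterior
  probability; \<open>false_positives\<close> is the analogue for nulls.\<close>

definition true_positives :: "nat \<Rightarrow> ((nat \<Rightarrow> 'a) \<Rightarrow> (nat \<Rightarrow> bool) measure) \<Rightarrow> real" where
  "true_positives n K = (\<integral>(x, \<delta>). (\<Sum>i<n. of_bool (\<delta> i) * eta (x i)) \<partial>Q n K)"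

definition false_positives :: "nat \<Rightarrow> ((nat \<Rightarrow> 'a) \<Rightarrow> (nat \<Rightarrow> bool) measure) \<Rightarrow> real" where
  "false_positives n K = (\<integral>(x, \<delta>). (\<Sum>i<n. of_bool (\<delta> i) * (1 - eta (x i))) \<partial>Q n K)"

text \<open>The common form of the error rates: labels enter linearly, with weights \<psi> fixed by
  the decisions. False discoveries take \<open>t = False\<close>, non-nulls take
  \<open>t = True\<close>.\<close>

lemma integral_label_sum:
  assumes K: "decision_rule M n K" and \<psi>: "\<And>i \<delta>. 0 \<le> \<psi> i \<delta>" "\<And>i \<delta>. \<psi> i \<delta> \<le> 1"
  shows "(\<integral>(\<theta>, x, \<delta>). (\<Sum>i<n. of_bool (\<theta> i = t) * \<psi> i \<delta>) \<partial>joint_law \<pi>1 M f0 f1 n K) =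
    (\<integral>(x, \<delta>). (\<Sum>i<n. post t (x i) * \<psi> i \<delta>) \<partial>Q n K)"
proof -
  have [measurable]: "\<psi> i \<in> borel_measurable (binary_space n)" for i
    by (rule measurable_from_binary_space)
  have 1: "integrable (joint_law \<pi>1 M f0 f1 n K) (\<lambda>(\<theta>, x, \<delta>). of_bool (\<theta> i = t) * \<psi> i \<delta>)"
    if "i < n" for i
    using that \<psi> by (intro integrable_joint_law[OF K, where C = 1]) (auto split: prod.split)
  have 2: "integrable (Q n K) (\<lambda>(x, \<delta>). post t (x i) * \<psi> i \<delta>)" if "i < n" for i
    using that \<psi> post_bounds[of t]
    by (intro integrable_Q[OF K, where C = 1]) (auto split: prod.split intro: mult_le_one)
  have "(\<integral>(\<theta>, x, \<delta>). (\<Sum>i<n. of_bool (\<theta> i = t) * \<psi> i \<delta>) \<partial>joint_law \<pi>1 M f0 f1 n K) =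
      (\<Sum>i<n. \<integral>(\<theta>, x, \<delta>). of_bool (\<theta> i = t) * \<psi> i \<delta> \<partial>joint_law \<pi>1 M f0 f1 n K)"
    using 1 by (subst Bochner_Integration.integral_sum[symmetric]) (auto simp: case_prod_beta')
  also have "\<dots> = (\<Sum>i<n. \<integral>(x, \<delta>). post t (x i) * \<psi> i \<delta> \<partial>Q n K)"
    by (intro sum.cong refl integral_label_given_data[OF K]) (use \<psi> in auto)
  also have "\<dots> = (\<integral>(x, \<delta>). (\<Sum>i<n. post t (x i) * \<psi> i \<delta>) \<partial>Q n K)"
    using 2 by (subst Bochner_Integration.integral_sum[symmetric]) (auto simp: case_prod_beta')
  finally show ?thesis .
qed

text \<open>The denominator is a function of the decisions, so the false discovery proportion is
  still linear in the labels, with weights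
  \<open>of_bool (\<delta> i) / max 1 (rejections n \<delta>)\<close> in [0,1].\<close>

lemma FDR_eq:
  assumes K: "decision_rule M n K"
  shows "FDR \<pi>1 M f0 f1 n K =
    (\<integral>(x, \<delta>). (\<Sum>i<n. of_bool (\<delta> i) * (1 - eta (x i))) / max 1 (rejections n \<delta>) \<partial>Q n K)"
proof -
  have "FDR \<pi>1 M f0 f1 n K =
     (\<integral>(\<theta>, x, \<delta>). (\<Sum>i<n. of_bool (\<theta> i = False) * (of_bool (\<delta> i) / max 1 (rejections n \<delta>))) \<partial>joint_law \<pi>1 M f0 f1 n K)"
    unfolding FDR_def false_discoveries_def sum_divide_distrib
    by (intro arg_cong2[where f = "integral\<^sup>L"]) (auto simp: fun_eq_iff intro!: sum.cong)
  also have "\<dots> = (\<integral>(x, \<delta>). (\<Sum>i<n. post False (x i) * (of_bool (\<delta> i) / max 1 (rejections n \<delta>))) \<partial>Q n K)"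
    by (rule integral_label_sum[OF K]) (auto simp: max_def)
  also have "\<dots> = (\<integral>(x, \<delta>). (\<Sum>i<n. of_bool (\<delta> i) * (1 - eta (x i))) / max 1 (rejections n \<delta>) \<partial>Q n K)"
    unfolding sum_divide_distrib
    by (intro arg_cong2[where f = "integral\<^sup>L"]) (auto simp: fun_eq_iff post_def intro!: sum.cong)
  finally show ?thesis .
qed

lemma integral_false_discoveries:
  assumes K: "decision_rule M n K"
  shows "(\<integral>(\<theta>, x, \<delta>). false_discoveries n \<theta> \<delta> \<partial>joint_law \<pi>1 M f0 f1 n K) = false_positives n K"
proof -
  have "(\<integral>(\<theta>, x, \<delta>). false_discoveries n \<theta> \<delta> \<partial>joint_law \<pi>1 M f0 f1 n K) =
     (\<integral>(\<theta>, x, \<delta>). (\<Sum>i<n. of_bool (\<theta> i = False) * (of_bool (\<delta> i))) \<partial>joint_law \<pi>1 M f0 f1 n K)"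
    unfolding false_discoveries_def
    by (intro arg_cong2[where f = "integral\<^sup>L"]) (auto simp: fun_eq_iff intro!: sum.cong)
  also have "\<dots> = (\<integral>(x, \<delta>). (\<Sum>i<n. post False (x i) * (of_bool (\<delta> i))) \<partial>Q n K)"
    by (rule integral_label_sum[OF K]) auto
  also have "\<dots> = false_positives n K"
    unfolding false_positives_def
    by (intro arg_cong2[where f = "integral\<^sup>L"]) (auto simp: fun_eq_iff post_def intro!: sum.cong)
  finally show ?thesis .
qed

lemma integral_true_discoveries:
  assumes K: "decision_rule M n K"
  shows "(\<integral>(\<theta>, x, \<delta>). (\<Sum>i<n. of_bool (\<theta> i = True) * of_bool (\<delta> i)) \<partial>joint_law \<pi>1 M f0 f1 n K) = true_positives n K"
proof -
  have "(\<integral>(\<theta>, x, \<delta>). (\<Sum>i<n. of_bool (\<theta> i = True) * of_bool (\<delta> i)) \<partial>joint_law \<pi>1 M f0 f1 n K) =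
     (\<integral>(x, \<delta>). (\<Sum>i<n. post True (x i) * (of_bool (\<delta> i))) \<partial>Q n K)"
    by (rule integral_label_sum[OF K]) auto
  also have "\<dots> = true_positives n K"
    unfolding true_positives_def
    by (intro arg_cong2[where f = "integral\<^sup>L"]) (auto simp: fun_eq_iff post_def intro!: sum.cong)
  finally show ?thesis .
qed

lemma abs_sum_unit_le:
  fixes a :: "nat \<Rightarrow> real"
  assumes "\<And>i. 0 \<le> a i" "\<And>i. a i \<le> 1"
  shows "\<bar>\<Sum>i<n. a i\<bar> \<le> real n"
proof -
  have "(\<Sum>i<n. a i) \<le> (\<Sum>i<n. 1)" by (rule sum_mono) (rule assms)
  then show ?thesis using assms by (auto simp: sum_nonneg)
qed

text \<open>Each rejection is either true or false, so the expected number of rejections is the sum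
  of the two expectations. The convention for 0/0 is the same on both sides.\<close>

lemma mFDR_eq:
  assumes K: "decision_rule M n K"
  shows "mFDR \<pi>1 M f0 f1 n K = false_positives n K / (false_positives n K + true_positives n K)"
proof -
  have i1: "integrable (joint_law \<pi>1 M f0 f1 n K) (\<lambda>(\<theta>, x, \<delta>). false_discoveries n \<theta> \<delta>)"
    unfolding false_discoveries_def
    by (rule integrable_joint_law[OF K, where C = "real n"])
      (auto intro!: abs_sum_unit_le split: prod.split)
  have i2: "integrable (joint_law \<pi>1 M f0 f1 n K) (\<lambda>(\<theta>, x, \<delta>). (\<Sum>i<n. of_bool (\<theta> i = True) * of_bool (\<delta> i)) :: real)"
    by (rule integrable_joint_law[OF K, where C = "real n"])
      (auto intro!: abs_sum_unit_le split: prod.split)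
  have "rejections n \<delta> = false_discoveries n \<theta> \<delta> + (\<Sum>i<n. of_bool (\<theta> i = True) * of_bool (\<delta> i))" for \<theta> \<delta>
    unfolding rejections_def false_discoveries_def sum.distrib[symmetric] by (intro sum.cong) auto
  then have "(\<integral>(\<theta>, x, \<delta>). rejections n \<delta> \<partial>joint_law \<pi>1 M f0 f1 n K) =
    (\<integral>p. (case p of (\<theta>, x, \<delta>) \<Rightarrow> false_discoveries n \<theta> \<delta>) +
       (case p of (\<theta>, x, \<delta>) \<Rightarrow> (\<Sum>i<n. of_bool (\<theta> i = True) * of_bool (\<delta> i))) \<partial>joint_law \<pi>1 M f0 f1 n K)"
    by (intro arg_cong2[where f = "integral\<^sup>L"]) (auto simp: fun_eq_iff)
  also have "\<dots> = false_positives n K + true_positives n K"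
    unfolding Bochner_Integration.integral_add[OF i1 i2]
      integral_false_discoveries[OF K] integral_true_discoveries[OF K] ..
  finally show ?thesis by (simp add: mFDR_def integral_false_discoveries[OF K])
qed

lemma integral_Q:
  fixes F :: "_ \<Rightarrow> real"
  assumes K: "decision_rule M n K"
    and F[measurable]: "F \<in> borel_measurable (obs_space M n \<Otimes>\<^sub>M binary_space n)"
    and C: "\<And>p. 0 \<le> F p" "\<And>p. F p \<le> C"
  shows "(\<integral>p. F p \<partial>Q n K) = (\<integral>x. \<integral>\<delta>. F (x, \<delta>) \<partial>K x \<partial>P n)"
proof -
  have inner: "(\<integral>\<^sup>+\<delta>. ennreal (F (x, \<delta>)) \<partial>K x) = ennreal (\<integral>\<delta>. F (x, \<delta>) \<partial>K x)"
    if x: "x \<in> space (obs_space M n)" for x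
  proof -
    interpret Kx: prob_space "K x" by (rule decision_ruleD[OF K x])
    have "(\<lambda>\<delta>. F (x, \<delta>)) \<in> borel_measurable (K x)"
      using measurable_compose[OF measurable_Pair1'[OF x] F]
      by (simp add: measurable_cong_sets[OF decision_ruleD(2)[OF K x] refl])
    then show ?thesis
      using C by (intro nn_integral_eq_integral Kx.integrable_const_bound[where B = C]) auto
  qed
  have "(\<lambda>x. enn2real (\<integral>\<^sup>+\<delta>. ennreal (F (x, \<delta>)) \<partial>K x)) \<in> borel_measurable (obs_space M n)"
    by (intro borel_measurable_enn2real measurable_nn_kernel[OF K]) measurable
  then have meas: "(\<lambda>x. \<integral>\<delta>. F (x, \<delta>) \<partial>K x) \<in> borel_measurable (obs_space M n)"
    by (rule measurable_cong[THEN iffD1, rotated]) (use C in \<open>simp add: inner\<close>)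
  have "(\<integral>p. F p \<partial>Q n K) = enn2real (\<integral>\<^sup>+p. ennreal (F p) \<partial>Q n K)"
    by (rule integral_eq_nn_integral)
      (use C in \<open>auto simp: measurable_cong_sets[OF sets_Q[OF K] refl]\<close>)
  also have "(\<integral>\<^sup>+p. ennreal (F p) \<partial>Q n K) = (\<integral>\<^sup>+x. \<integral>\<^sup>+\<delta>. ennreal (F (x, \<delta>)) \<partial>K x \<partial>P n)"
    by (rule nn_integral_Q[OF K]) measurable
  also have "\<dots> = (\<integral>\<^sup>+x. ennreal (\<integral>\<delta>. F (x, \<delta>) \<partial>K x) \<partial>P n)"
    by (intro nn_integral_cong inner) (simp add: sets_eq_imp_space_eq[OF sets_P])
  also have "enn2real \<dots> = (\<integral>x. \<integral>\<delta>. F (x, \<delta>) \<partial>K x \<partial>P n)"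
    by (rule integral_eq_nn_integral[symmetric])
      (use C meas in \<open>auto simp: measurable_cong_sets[OF sets_P refl] intro: integral_nonneg\<close>)
  finally show ?thesis .
qed

lemma integral_Q_data:
  fixes g :: "_ \<Rightarrow> real"
  assumes K: "decision_rule M n K" and g[measurable]: "g \<in> borel_measurable (obs_space M n)"
    and C: "\<And>p. 0 \<le> g p" "\<And>p. g p \<le> C"
  shows "(\<integral>(x, \<delta>). g x \<partial>Q n K) = (\<integral>x. g x \<partial>P n)"
proof -
  have "(\<integral>(x, \<delta>). g x \<partial>Q n K) = (\<integral>x. \<integral>\<delta>. (case (x, \<delta>) of (x, \<delta>) \<Rightarrow> g x) \<partial>K x \<partial>P n)"
    by (rule integral_Q[OF K, where C = C]) (use C in auto)
  also have "\<dots> = (\<integral>x. g x \<partial>P n)"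
  proof (rule Bochner_Integration.integral_cong[OF refl])
    fix x assume "x \<in> space (P n)"
    then have x: "x \<in> space (obs_space M n)" by (simp add: sets_eq_imp_space_eq[OF sets_P])
    interpret Kx: prob_space "K x" by (rule decision_ruleD[OF K x])
    show "(\<integral>\<delta>. (case (x, \<delta>) of (x, \<delta>) \<Rightarrow> g x) \<partial>K x) = g x" by (simp add: Kx.prob_space)
  qed
  finally show ?thesis .
qed

text \<open>False negatives are the non-nulls minus the true rejections, and the expected proportion
  of non-nulls is the mean of \<open>eta\<close>.\<close>

lemma EFN_eq:
  assumes K: "decision_rule M n K" and n: "1 \<le> n"
  shows "EFN \<pi>1 M f0 f1 n K = \<pi>1 - true_positives n K / n"
proof -
  have i2: "integrable (joint_law \<pi>1 M f0 f1 n K) (\<lambda>(\<theta>, x, \<delta>). (\<Sum>i<n. of_bool (\<theta> i = True) * c \<delta> i))"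
    if "\<And>\<delta> i. 0 \<le> c \<delta> i" "\<And>\<delta> i. c \<delta> i \<le> (1 :: real)" for c
  proof -
    have [measurable]: "(\<lambda>\<delta>. c \<delta> i) \<in> borel_measurable (binary_space n)" for i
      by (rule measurable_from_binary_space)
    show ?thesis
      by (rule integrable_joint_law[OF K, where C = "real n"])
        (measurable, use that in \<open>auto intro!: abs_sum_unit_le split: prod.split\<close>)
  qed
  have i3: "integrable (Q n K) (\<lambda>(x, \<delta>). eta (x i))" if "i < n" for i
    using that eta_bounds by (intro integrable_Q[OF K, where C = 1]) (auto)
  \<comment> \<open>The factor 1 is the weight \<psi> of \<open>integral_label_sum\<close>: all
    non-nulls are counted, whatever the decision.\<close>
  have "(\<integral>(\<theta>, x, \<delta>). (\<Sum>i<n. of_bool (\<theta> i = True) * 1) \<partial>joint_law \<pi>1 M f0 f1 n K)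
     = (\<integral>(x, \<delta>). (\<Sum>i<n. post True (x i) * 1) \<partial>Q n K)"
    by (rule integral_label_sum[OF K]) auto
  also have "\<dots> = (\<Sum>i<n. \<integral>(x, \<delta>). eta (x i) \<partial>Q n K)"
    using i3 by (subst Bochner_Integration.integral_sum[symmetric]) (auto simp: case_prod_beta' post_def)
  also have "\<dots> = (\<Sum>i<n. \<pi>1)"
  proof (rule sum.cong[OF refl])
    fix i assume i: "i \<in> {..<n}"
    have "(\<integral>(x, \<delta>). eta (x i) \<partial>Q n K) = (\<integral>x. eta (x i) \<partial>P n)"
      by (rule integral_Q_data[OF K, where C = 1]) (use i eta_bounds in auto)
    also have "\<dots> = (\<integral>x. eta x \<partial>mu)"
      by (rule integral_PiM_coordinate) (use i prob_space_mu in auto)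
    finally show "(\<integral>(x, \<delta>). eta (x i) \<partial>Q n K) = \<pi>1" by (simp add: integral_eta)
  qed
  finally have 1: "(\<integral>(\<theta>, x, \<delta>). (\<Sum>i<n. of_bool (\<theta> i = True) * 1) \<partial>joint_law \<pi>1 M f0 f1 n K) = n * \<pi>1"
    by simp
  have "(\<integral>(\<theta>, x, \<delta>). false_negatives n \<theta> \<delta> \<partial>joint_law \<pi>1 M f0 f1 n K) =
    (\<integral>p. (case p of (\<theta>, x, \<delta>) \<Rightarrow> (\<Sum>i<n. of_bool (\<theta> i = True) * 1)) -
       (case p of (\<theta>, x, \<delta>) \<Rightarrow> (\<Sum>i<n. of_bool (\<theta> i = True) * of_bool (\<delta> i))) \<partial>joint_law \<pi>1 M f0 f1 n K)"
    unfolding false_negatives_def case_prod_beta' sum_subtractf[symmetric]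
    by (simp add: right_diff_distrib)
  also have "\<dots> = n * \<pi>1 - true_positives n K"
    by (subst Bochner_Integration.integral_diff)
      (use i2[of "\<lambda>_ _. 1"] i2[of "\<lambda>\<delta> i. of_bool (\<delta> i)"] 1 integral_true_discoveries[OF K] in auto)
  finally show ?thesis using n by (simp add: EFN_def field_simps)
qed

end

section \<open>Independent tests and randomization\<close>

text \<open>On a finite discrete space the mass of a set is a finite sum of point masses, so
  measurability of the point masses is enough.\<close>

lemma measurable_prob_algebra_count_space:
  assumes S: "finite S"
    and K: "\<And>x. x \<in> space N \<Longrightarrow> prob_space (K x)" "\<And>x. x \<in> space N \<Longrightarrow> sets (K x) = Pow S"
    and meas: "\<And>s. s \<in> S \<Longrightarrow> (\<lambda>x. emeasure (K x) {s}) \<in> borel_measurable N"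
  shows "K \<in> N \<rightarrow>\<^sub>M prob_algebra (count_space S)"
proof (intro measurable_prob_algebraI measurable_subprob_algebra K(1))
  fix A assume "A \<in> sets (count_space S)"
  then have A: "A \<subseteq> S" by simp
  then have fA: "finite A" using S finite_subset by blast
  have "(\<lambda>x. \<Sum>s\<in>A. emeasure (K x) {s}) \<in> borel_measurable N"
    using A meas by (intro borel_measurable_sum) auto
  also have "?this \<longleftrightarrow> (\<lambda>x. emeasure (K x) A) \<in> borel_measurable N"
    using A fA K(2) by (intro measurable_cong emeasure_eq_sum_singleton[symmetric]) auto
  finally show "(\<lambda>x. emeasure (K x) A) \<in> borel_measurable N" .
qed (use K in \<open>auto intro: prob_space_imp_subprob_space\<close>)

abbreviation bernoulli_product :: "nat \<Rightarrow> (nat \<Rightarrow> real) \<Rightarrow> (nat \<Rightarrow> bool) measure" where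
  "bernoulli_product n q \<equiv> \<Pi>\<^sub>M i\<in>{..<n}. measure_pmf (bernoulli_pmf (q i))"

lemma prob_space_bernoulli_product: "prob_space (bernoulli_product n q)"
  by (rule prob_space_PiM) (rule measure_pmf.prob_space_axioms)

lemma sets_bernoulli_product: "sets (bernoulli_product n q) = sets (binary_space n)"
  unfolding binary_space_def by (rule sets_PiM_cong) auto

lemma integrable_bernoulli_product:
  fixes h :: "(nat \<Rightarrow> bool) \<Rightarrow> real"
  assumes "\<And>\<delta>. \<bar>h \<delta>\<bar> \<le> C"
  shows "integrable (bernoulli_product n q) h"
proof -
  interpret prob_space "bernoulli_product n q" by (rule prob_space_bernoulli_product)
  show ?thesis
    by (rule integrable_const_bound[where B = C])
      (use assms in \<open>auto simp: measurable_cong_sets[OF sets_bernoulli_product refl] measurable_from_binary_space\<close>)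
qed

lemma emeasure_bernoulli_product:
  assumes "\<delta> \<in> PiE {..<n} (\<lambda>_. UNIV)" and "\<And>i. i < n \<Longrightarrow> 0 \<le> q i" "\<And>i. i < n \<Longrightarrow> q i \<le> 1"
  shows "emeasure (bernoulli_product n q) {\<delta>} = (\<Prod>i<n. ennreal (if \<delta> i then q i else 1 - q i))"
proof -
  interpret product_sigma_finite "\<lambda>i. measure_pmf (bernoulli_pmf (q i))"
    by (rule product_sigma_finite.intro) (rule measure_pmf.sigma_finite_measure_axioms)
  have "{\<delta>} = PiE {..<n} (\<lambda>i. {\<delta> i})" using assms(1) by (simp add: PiE_singleton PiE_iff)
  then have "emeasure (bernoulli_product n q) {\<delta>} =
      (\<Prod>i<n. emeasure (measure_pmf (bernoulli_pmf (q i))) {\<delta> i})"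
    by (simp add: emeasure_PiM)
  also have "\<dots> = (\<Prod>i<n. ennreal (if \<delta> i then q i else 1 - q i))"
  proof (intro prod.cong refl)
    fix i assume "i \<in> {..<n}"
    then show "emeasure (measure_pmf (bernoulli_pmf (q i))) {\<delta> i} = ennreal (if \<delta> i then q i else 1 - q i)"
      using assms by (cases "\<delta> i") (auto simp: emeasure_pmf_single)
  qed
  finally show ?thesis .
qed

definition other_rejections :: "nat \<Rightarrow> nat \<Rightarrow> (nat \<Rightarrow> bool) \<Rightarrow> real" where
  "other_rejections n i \<delta> = (\<Sum>j\<in>{..<n} - {i}. of_bool (\<delta> j))"

lemma other_rejections_nonneg: "0 \<le> other_rejections n i \<delta>"
  unfolding other_rejections_def by (rule sum_nonneg) simp

text \<open>If \<open>i\<close> is rejected, the total is one plus the other rejections and the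
  maximum has no effect. The new denominator does not involve \<open>\<delta> i\<close>, so under
  independent decisions the two factors are independent.\<close>

lemma reject_div_rejections:
  assumes "i < n"
  shows "of_bool (\<delta> i) / max 1 (rejections n \<delta>) = of_bool (\<delta> i) * (1 / (1 + other_rejections n i \<delta>))"
proof -
  have "rejections n \<delta> = of_bool (\<delta> i) + other_rejections n i \<delta>"
    unfolding rejections_def other_rejections_def using assms by (subst sum.remove[of _ i]) auto
  then show ?thesis using other_rejections_nonneg[of n i \<delta>] by auto
qed

definition other_rejections_mean :: "nat \<Rightarrow> nat \<Rightarrow> (nat \<Rightarrow> real) \<Rightarrow> real" where
  "other_rejections_mean n i q = (\<integral>\<delta>. 1 / (1 + other_rejections n i \<delta>) \<partial>bernoulli_product n q)"

text \<open>The integrand ignores coordinate \<open>i\<close>, so the integral can be taken over the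
  product without it (\<open>red\<close>). In \<open>tests_rule_FDP\<close> this is the invariance
  under changes of \<open>x i\<close> on which the factorization rests.\<close>

lemma other_rejections_mean_cong:
  assumes "\<And>j. j < n \<Longrightarrow> j \<noteq> i \<Longrightarrow> q j = q' j"
  shows "other_rejections_mean n i q = other_rejections_mean n i q'"
proof -
  define J where "J = {..<n} - {i}"
  define h :: "(nat \<Rightarrow> bool) \<Rightarrow> real" where "h \<delta> = 1 / (1 + (\<Sum>j\<in>J. of_bool (\<delta> j)))" for \<delta>
  have red: "other_rejections_mean n i q = (\<integral>\<delta>. h \<delta> \<partial>(\<Pi>\<^sub>M j\<in>J. measure_pmf (bernoulli_pmf (q j))))" for q
  proof -
    interpret product_prob_space "\<lambda>j. measure_pmf (bernoulli_pmf (q j))" "{..<n}"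
      by (intro product_prob_spaceI measure_pmf.prob_space_axioms)
    let ?N = "\<Pi>\<^sub>M j\<in>J. measure_pmf (bernoulli_pmf (q j))"
    have "sets ?N = sets (\<Pi>\<^sub>M j\<in>J. count_space UNIV)" by (rule sets_PiM_cong) auto
    also have "(\<Pi>\<^sub>M j\<in>J. count_space (UNIV :: bool set)) = count_space (PiE J (\<lambda>_. UNIV))"
      by (rule count_space_PiM_finite) (auto simp: J_def)
    finally have s: "sets ?N = sets (count_space (PiE J (\<lambda>_. UNIV)))" .
    have h: "h \<in> borel_measurable ?N"
      unfolding measurable_cong_sets[OF s refl] by simp
    have "(\<integral>\<delta>. h \<delta> \<partial>?N) = (\<integral>\<delta>. h \<delta> \<partial>distr (bernoulli_product n q) ?N (\<lambda>\<delta>. restrict \<delta> J))"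
      by (subst distr_PiM_restrict_finite) (auto simp: J_def measure_pmf.prob_space_axioms)
    also have "\<dots> = (\<integral>\<delta>. h (restrict \<delta> J) \<partial>bernoulli_product n q)"
      by (rule integral_distr[OF _ h]) (auto simp: J_def intro!: measurable_restrict_subset)
    also have "\<dots> = other_rejections_mean n i q"
      unfolding other_rejections_mean_def
      by (intro Bochner_Integration.integral_cong refl)
        (auto simp: h_def other_rejections_def J_def intro!: sum.cong)
    finally show ?thesis ..
  qed
  have "(\<Pi>\<^sub>M j\<in>J. measure_pmf (bernoulli_pmf (q j))) = (\<Pi>\<^sub>M j\<in>J. measure_pmf (bernoulli_pmf (q' j)))"
    using assms by (intro PiM_cong) (auto simp: J_def)
  then show ?thesis by (simp add: red)
qed

lemma integral_bernoulli_product_coordinate: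
  assumes "i < n" "0 \<le> q i" "q i \<le> 1"
  shows "(\<integral>\<delta>. of_bool (\<delta> i) \<partial>bernoulli_product n q) = (q i :: real)"
proof -
  have "(\<integral>\<delta>. of_bool (\<delta> i) \<partial>bernoulli_product n q) =
      (\<integral>b. of_bool b \<partial>measure_pmf (bernoulli_pmf (q i)) :: real)"
    by (rule integral_PiM_coordinate[where g = of_bool]) (use assms in \<open>auto simp: measure_pmf.prob_space_axioms\<close>)
  then show ?thesis using assms by simp
qed

lemma integral_bernoulli_product_reject:
  assumes "i < n" "0 \<le> q i" "q i \<le> 1"
  shows "(\<integral>\<delta>. of_bool (\<delta> i) / max 1 (rejections n \<delta>) \<partial>bernoulli_product n q) =
    q i * other_rejections_mean n i q"
proof -
  have "(\<integral>\<delta>. of_bool (\<delta> i) / max 1 (rejections n \<delta>) \<partial>bernoulli_product n q) =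
    (\<integral>\<delta>. of_bool (\<delta> i) * (1 / (1 + other_rejections n i \<delta>)) \<partial>bernoulli_product n q)"
    using assms by (simp only: reject_div_rejections)
  also have "\<dots> = (\<integral>b. of_bool b \<partial>measure_pmf (bernoulli_pmf (q i))) * other_rejections_mean n i q"
    unfolding other_rejections_mean_def
  proof (rule integral_PiM_mult_coordinate)
    show "integrable (bernoulli_product n q) (\<lambda>\<delta>. of_bool (\<delta> i) * (1 / (1 + other_rejections n i \<delta>)))"
      by (rule integrable_bernoulli_product[where C = 1])
        (use other_rejections_nonneg[of n i] in \<open>auto simp: abs_of_nonneg add_nonneg_nonneg divide_le_eq\<close>)
    show "1 / (1 + other_rejections n i (\<delta>(i := b))) = 1 / (1 + other_rejections n i \<delta>)" for \<delta> b
      unfolding other_rejections_def by (auto intro!: arg_cong2[where f = "(/)"] sum.cong)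
  qed (use assms measure_pmf.prob_space_axioms in auto)
  finally show ?thesis using assms by simp
qed

section \<open>Rates of one test applied independently to all hypotheses\<close>

context two_group
begin

text \<open>A randomized test of one hypothesis: \<open>\<phi> x\<close> is the probability of
  rejecting on observing \<open>x\<close>. The bounds are required outside \<open>space M\<close>
  too, which avoids side conditions later and explains the truncations in \<open>eta\<close> and in
  \<open>ex_test_of_rule\<close>.\<close>

definition test :: "('a \<Rightarrow> real) \<Rightarrow> bool" where
  "test \<phi> \<longleftrightarrow> \<phi> \<in> borel_measurable M \<and> (\<forall>x. 0 \<le> \<phi> x \<and> \<phi> x \<le> 1)"

definition tests_rule :: "('a \<Rightarrow> real) \<Rightarrow> nat \<Rightarrow> (nat \<Rightarrow> 'a) \<Rightarrow> (nat \<Rightarrow> bool) measure" where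
  "tests_rule \<phi> n x = bernoulli_product n (\<lambda>i. \<phi> (x i))"

lemma decision_rule_tests_rule:
  assumes \<phi>: "test \<phi>"
  shows "decision_rule M n (tests_rule \<phi> n)"
  unfolding decision_rule_def binary_space_eq
proof (rule measurable_prob_algebra_count_space)
  fix x
  show "prob_space (tests_rule \<phi> n x)"
    unfolding tests_rule_def by (rule prob_space_bernoulli_product)
  show "sets (tests_rule \<phi> n x) = Pow (PiE {..<n} (\<lambda>_. UNIV))"
    unfolding tests_rule_def sets_bernoulli_product binary_space_eq by simp
next
  fix \<delta> :: "nat \<Rightarrow> bool" assume d: "\<delta> \<in> PiE {..<n} (\<lambda>_. UNIV)"
  have [measurable]: "(\<lambda>x. \<phi> (x i)) \<in> borel_measurable (obs_space M n)" if "i < n" for i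
    using that \<phi> unfolding test_def
    by (blast intro: measurable_compose[OF measurable_obs_coordinate])
  have "(\<lambda>x. \<Prod>i<n. ennreal (if \<delta> i then \<phi> (x i) else 1 - \<phi> (x i))) \<in> borel_measurable (obs_space M n)"
    by measurable
  then show "(\<lambda>x. emeasure (tests_rule \<phi> n x) {\<delta>}) \<in> borel_measurable (obs_space M n)"
    unfolding tests_rule_def using d \<phi> by (simp add: emeasure_bernoulli_product test_def)
qed (auto intro: finite_PiE)

text \<open>One formula for several uses: \<open>w\<close> will be \<open>eta\<close>,
  \<open>1 - eta\<close> or 1, and \<open>\<psi> i\<close> either the decision on \<open>i\<close>
  or its share in all rejections.\<close>

lemma integral_Q_weighted:
  fixes w :: "'a \<Rightarrow> real"
  assumes K: "decision_rule M n K" and w[measurable]: "w \<in> borel_measurable M" "\<And>x. 0 \<le> w x" "\<And>x. w x \<le> 1"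
    and \<psi>: "\<And>i \<delta>. 0 \<le> \<psi> i \<delta>" "\<And>i \<delta>. \<psi> i \<delta> \<le> 1"
  shows "(\<integral>(x, \<delta>). (\<Sum>i<n. \<psi> i \<delta> * w (x i)) \<partial>Q n K) =
    (\<Sum>i<n. \<integral>x. w (x i) * (\<integral>\<delta>. \<psi> i \<delta> \<partial>K x) \<partial>P n)"
proof -
  have [measurable]: "(\<lambda>x. w (x i)) \<in> borel_measurable (obs_space M n)" if "i < n" for i
    using that by (rule measurable_compose[OF measurable_obs_coordinate w(1)])
  have [measurable]: "\<psi> i \<in> borel_measurable (binary_space n)" for i
    by (rule measurable_from_binary_space)
  have b: "0 \<le> \<psi> i \<delta> * w x" for i \<delta> x
    by (intro mult_nonneg_nonneg w \<psi>)
  have b': "\<psi> i \<delta> * w x \<le> 1" for i \<delta> x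
    by (intro mult_le_one w \<psi>)
  have "(\<integral>(x, \<delta>). (\<Sum>i<n. \<psi> i \<delta> * w (x i)) \<partial>Q n K) = (\<Sum>i<n. \<integral>(x, \<delta>). \<psi> i \<delta> * w (x i) \<partial>Q n K)"
    unfolding case_prod_beta'
    by (rule Bochner_Integration.integral_sum, rule integrable_Q[OF K, where C = 1])
      (use b b' in \<open>auto simp: abs_of_nonneg\<close>)
  also have "\<dots> = (\<Sum>i<n. \<integral>x. \<integral>\<delta>. (case (x, \<delta>) of (x, \<delta>) \<Rightarrow> \<psi> i \<delta> * w (x i)) \<partial>K x \<partial>P n)"
    by (intro sum.cong refl integral_Q[OF K, where C = 1]) (use b b' in auto)
  finally show ?thesis by (simp add: mult.commute)
qed

lemma integral_kernel_bounds:
  fixes \<psi> :: "(nat \<Rightarrow> bool) \<Rightarrow> real"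
  assumes K: "decision_rule M n K" and \<psi>: "\<And>\<delta>. 0 \<le> \<psi> \<delta>" "\<And>\<delta>. \<psi> \<delta> \<le> 1"
  shows "(\<lambda>x. \<integral>\<delta>. \<psi> \<delta> \<partial>K x) \<in> borel_measurable (obs_space M n)"
    and "x \<in> space (obs_space M n) \<Longrightarrow> (\<integral>\<delta>. \<psi> \<delta> \<partial>K x) \<le> 1"
    and "0 \<le> (\<integral>\<delta>. \<psi> \<delta> \<partial>K x)"
proof -
  have m: "\<psi> \<in> borel_measurable (binary_space n)" by (rule measurable_from_binary_space)
  have "K \<in> obs_space M n \<rightarrow>\<^sub>M subprob_algebra (binary_space n)"
    using K by (simp add: decision_rule_def measurable_prob_algebraD)
  then show "(\<lambda>x. \<integral>\<delta>. \<psi> \<delta> \<partial>K x) \<in> borel_measurable (obs_space M n)"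
    by (rule measurable_compose) (rule integral_measurable_subprob_algebra[OF m])
  show "0 \<le> (\<integral>\<delta>. \<psi> \<delta> \<partial>K x)" by (rule Bochner_Integration.integral_nonneg) (rule \<psi>)
  assume x: "x \<in> space (obs_space M n)"
  interpret Kx: prob_space "K x" by (rule decision_ruleD[OF K x])
  have "(\<integral>\<delta>. \<psi> \<delta> \<partial>K x) \<le> (\<integral>\<delta>. 1 \<partial>K x)"
    using m \<psi>
    by (intro integral_mono Kx.integrable_const_bound[where B = 1])
      (auto simp: measurable_cong_sets[OF decision_ruleD(2)[OF K x] refl])
  then show "(\<integral>\<delta>. \<psi> \<delta> \<partial>K x) \<le> 1" by (simp add: Kx.prob_space)
qed

lemma tests_rule_positives:
  assumes \<phi>: "test \<phi>" and w[measurable]: "w \<in> borel_measurable M" "\<And>x. 0 \<le> w x" "\<And>x. w x \<le> 1"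
  shows "(\<integral>(x, \<delta>). (\<Sum>i<n. of_bool (\<delta> i) * w (x i)) \<partial>Q n (tests_rule \<phi> n)) = n * (\<integral>x. \<phi> x * w x \<partial>mu)"
proof -
  have "(\<integral>(x, \<delta>). (\<Sum>i<n. of_bool (\<delta> i) * w (x i)) \<partial>Q n (tests_rule \<phi> n)) =
    (\<Sum>i<n. \<integral>x. w (x i) * (\<integral>\<delta>. of_bool (\<delta> i) \<partial>tests_rule \<phi> n x) \<partial>P n)"
    by (rule integral_Q_weighted[OF decision_rule_tests_rule[OF \<phi>] w]) auto
  also have "\<dots> = (\<Sum>i<n. \<integral>x. w (x i) * \<phi> (x i) \<partial>P n)"
    using \<phi> by (intro sum.cong refl)
      (simp add: tests_rule_def integral_bernoulli_product_coordinate test_def)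
  also have "\<dots> = (\<Sum>i<n. \<integral>x. w x * \<phi> x \<partial>mu)"
    by (intro sum.cong refl integral_PiM_coordinate[where g = "\<lambda>x. w x * \<phi> x"])
      (use \<phi> prob_space_mu in \<open>auto simp: test_def intro!: borel_measurable_times\<close>)
  finally show ?thesis by (simp add: mult.commute)
qed

text \<open>Given the data, the decision on \<open>i\<close> is governed by \<open>x i\<close>
  alone, while the reciprocal of one plus the other rejections is governed by the other
  observations. The expectation therefore factorizes, and the second factor is free of
  \<open>w\<close>: false discoveries and rejections share it.\<close>

lemma tests_rule_FDP:
  assumes \<phi>: "test \<phi>" and w[measurable]: "w \<in> borel_measurable M" "\<And>x. 0 \<le> w x" "\<And>x. w x \<le> 1"
  shows "(\<integral>(x, \<delta>). (\<Sum>i<n. of_bool (\<delta> i) / max 1 (rejections n \<delta>) * w (x i)) \<partial>Q n (tests_rule \<phi> n)) =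
    (\<integral>x. \<phi> x * w x \<partial>mu) * (\<Sum>i<n. \<integral>x. other_rejections_mean n i (\<lambda>i. \<phi> (x i)) \<partial>P n)"
proof -
  have K: "decision_rule M n (tests_rule \<phi> n)" by (rule decision_rule_tests_rule[OF \<phi>])
  have \<phi>m[measurable]: "\<phi> \<in> borel_measurable M" and \<phi>b: "\<And>x. 0 \<le> \<phi> x" "\<And>x. \<phi> x \<le> 1"
    using \<phi> by (auto simp: test_def)
  have [measurable]: "(\<lambda>x. w (x i)) \<in> borel_measurable (obs_space M n)" if "i < n" for i
    using that by (rule measurable_compose[OF measurable_obs_coordinate w(1)])
  have [measurable]: "(\<lambda>x. \<phi> (x i)) \<in> borel_measurable (obs_space M n)" if "i < n" for i
    using that by (rule measurable_compose[OF measurable_obs_coordinate \<phi>m])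
  define c where "c i x = other_rejections_mean n i (\<lambda>i. \<phi> (x i))" for i and x :: "nat \<Rightarrow> 'a"
  have h: "0 \<le> 1 / (1 + other_rejections n i \<delta>)" "1 / (1 + other_rejections n i \<delta>) \<le> 1" for i \<delta>
    using other_rejections_nonneg[of n i \<delta>] by auto
  have c: "c i \<in> borel_measurable (obs_space M n)" "0 \<le> c i x" "x \<in> space (obs_space M n) \<Longrightarrow> c i x \<le> 1" for i x
    using integral_kernel_bounds[OF K h(1)[of i] h(2)[of i]] unfolding c_def other_rejections_mean_def tests_rule_def by auto
  note [measurable] = c(1)
  have "(\<integral>(x, \<delta>). (\<Sum>i<n. of_bool (\<delta> i) / max 1 (rejections n \<delta>) * w (x i)) \<partial>Q n (tests_rule \<phi> n)) =
    (\<Sum>i<n. \<integral>x. w (x i) * (\<integral>\<delta>. of_bool (\<delta> i) / max 1 (rejections n \<delta>) \<partial>tests_rule \<phi> n x) \<partial>P n)"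
    by (rule integral_Q_weighted[OF K w]) (auto simp: max_def)
  also have "\<dots> = (\<Sum>i<n. \<integral>x. (w (x i) * \<phi> (x i)) * c i x \<partial>P n)"
    by (intro sum.cong refl)
      (simp add: tests_rule_def integral_bernoulli_product_reject \<phi>b c_def mult.assoc)
  also have "\<dots> = (\<Sum>i<n. (\<integral>x. w x * \<phi> x \<partial>mu) * (\<integral>x. c i x \<partial>P n))"
  proof (intro sum.cong refl integral_PiM_mult_coordinate[where g = "\<lambda>x. w x * \<phi> x"] prob_space_mu)
    fix i assume i: "i \<in> {..<n}"
    show "integrable (P n) (\<lambda>x. w (x i) * \<phi> (x i) * c i x)"
      by (rule integrable_P[where C = 1])
        (use i w \<phi>b c in \<open>auto simp: abs_mult intro!: mult_le_one mult_nonneg_nonneg\<close>)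
    show "c i (x(i := z)) = c i x" for x z
      unfolding c_def by (rule other_rejections_mean_cong) simp
  qed
  finally show ?thesis by (simp add: c_def mult.commute sum_distrib_left)
qed

lemma measurable_weights:
  "eta \<in> borel_measurable M" "(\<lambda>x. 1 - eta x) \<in> borel_measurable M"
  using measurable_eta_M by auto

text \<open>The probability that a single hypothesis is a non-null and gets rejected;
  \<open>false_mass\<close> is the analogue for nulls. The bounds below see a test only through
  these two numbers.\<close>

definition true_mass :: "('a \<Rightarrow> real) \<Rightarrow> real" where "true_mass \<phi> = (\<integral>x. \<phi> x * eta x \<partial>mu)"
definition false_mass :: "('a \<Rightarrow> real) \<Rightarrow> real" where "false_mass \<phi> = (\<integral>x. \<phi> x * (1 - eta x) \<partial>mu)"

lemma mass_nonneg: "test \<phi> \<Longrightarrow> 0 \<le> false_mass \<phi>" "test \<phi> \<Longrightarrow> 0 \<le> true_mass \<phi>"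
  using eta_bounds by (auto simp: false_mass_def true_mass_def test_def intro!: integral_nonneg)

lemma mass_add:
  assumes \<phi>: "test \<phi>"
  shows "false_mass \<phi> + true_mass \<phi> = (\<integral>x. \<phi> x \<partial>mu)"
proof -
  have [measurable]: "\<phi> \<in> borel_measurable mu"
    unfolding measurable_cong_sets[OF sets_mu refl] using \<phi> by (simp add: test_def)
  have "integrable mu (\<lambda>x. \<phi> x * (1 - eta x))" "integrable mu (\<lambda>x. \<phi> x * eta x)"
    using \<phi> eta_bounds
    by (auto intro!: integrable_mu[where C = 1] mult_le_one simp: test_def abs_mult)
  then have "false_mass \<phi> + true_mass \<phi> = (\<integral>x. \<phi> x * (1 - eta x) + \<phi> x * eta x \<partial>mu)"
    unfolding false_mass_def true_mass_def by (rule Bochner_Integration.integral_add[symmetric])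
  then show ?thesis by (simp add: algebra_simps)
qed

text \<open>For the last claim, the FDR is the mFDR multiplied by the probability of at least one
  rejection.\<close>

lemma tests_rule_rates:
  assumes \<phi>: "test \<phi>" and n: "1 \<le> n"
  shows "EFN \<pi>1 M f0 f1 n (tests_rule \<phi> n) = \<pi>1 - true_mass \<phi>"
    and "mFDR \<pi>1 M f0 f1 n (tests_rule \<phi> n) = false_mass \<phi> / (false_mass \<phi> + true_mass \<phi>)"
    and "FDR \<pi>1 M f0 f1 n (tests_rule \<phi> n) \<le> false_mass \<phi> / (false_mass \<phi> + true_mass \<phi>)"
proof -
  have K: "decision_rule M n (tests_rule \<phi> n)" by (rule decision_rule_tests_rule[OF \<phi>])
  have tp: "true_positives n (tests_rule \<phi> n) = n * true_mass \<phi>"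
    unfolding true_positives_def true_mass_def
    by (rule tests_rule_positives[OF \<phi>]) (use measurable_weights eta_bounds in auto)
  have fp: "false_positives n (tests_rule \<phi> n) = n * false_mass \<phi>"
    unfolding false_positives_def false_mass_def
    by (rule tests_rule_positives[OF \<phi>]) (use measurable_weights eta_bounds in auto)
  show "EFN \<pi>1 M f0 f1 n (tests_rule \<phi> n) = \<pi>1 - true_mass \<phi>"
    using n by (simp add: EFN_eq[OF K] tp)
  show "mFDR \<pi>1 M f0 f1 n (tests_rule \<phi> n) = false_mass \<phi> / (false_mass \<phi> + true_mass \<phi>)"
    using n unfolding mFDR_eq[OF K] tp fp distrib_left[symmetric] by simp
  define S where "S = (\<Sum>i<n. \<integral>x. other_rejections_mean n i (\<lambda>i. \<phi> (x i)) \<partial>P n)"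
  have fdr: "FDR \<pi>1 M f0 f1 n (tests_rule \<phi> n) = false_mass \<phi> * S"
  proof -
    have "FDR \<pi>1 M f0 f1 n (tests_rule \<phi> n) =
      (\<integral>(x, \<delta>). (\<Sum>i<n. of_bool (\<delta> i) / max 1 (rejections n \<delta>) * (1 - eta (x i))) \<partial>Q n (tests_rule \<phi> n))"
      unfolding FDR_eq[OF K] sum_divide_distrib by simp
    also have "\<dots> = false_mass \<phi> * S"
      unfolding S_def false_mass_def
      by (rule tests_rule_FDP[OF \<phi>]) (use measurable_weights eta_bounds in auto)
    finally show ?thesis .
  qed
  \<comment> \<open>With weight 1 in place of \<open>1 - eta\<close> the proportion becomes the
    indicator of at least one rejection. Its mean is at most 1, which bounds the common factor
    \<open>S\<close> by the reciprocal of the total mass.\<close>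
  have "(\<integral>x. \<phi> x * 1 \<partial>mu) * S =
      (\<integral>(x, \<delta>). (\<Sum>i<n. of_bool (\<delta> i) / max 1 (rejections n \<delta>) * 1) \<partial>Q n (tests_rule \<phi> n))"
    unfolding S_def by (rule tests_rule_FDP[OF \<phi>, symmetric]) auto
  also have "\<dots> = (\<integral>(x, \<delta>). rejections n \<delta> / max 1 (rejections n \<delta>) \<partial>Q n (tests_rule \<phi> n))"
    by (simp add: rejections_def sum_divide_distrib)
  also have "\<dots> \<le> (\<integral>p. 1 \<partial>Q n (tests_rule \<phi> n))"
  proof (rule integral_mono)
    have "(\<lambda>p. rejections n (snd p) / max 1 (rejections n (snd p)))
        \<in> borel_measurable (obs_space M n \<Otimes>\<^sub>M binary_space n)"
      by (rule measurable_compose[OF measurable_snd measurable_from_binary_space])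
    then show "integrable (Q n (tests_rule \<phi> n)) (\<lambda>(x, \<delta>). rejections n \<delta> / max 1 (rejections n \<delta>))"
      by (intro integrable_Q[OF K, where C = 1]) (simp add: case_prod_beta', auto simp: rejections_nonneg abs_of_nonneg max_def split: prod.split)
    show "integrable (Q n (tests_rule \<phi> n)) (\<lambda>p. 1 :: real)"
      by (rule integrable_Q[OF K, where C = 1]) auto
  qed (auto simp: rejections_nonneg max_def)
  also have "\<dots> = 1" using prob_space.prob_space[OF prob_space_Q[OF K]] by simp
  finally have *: "(false_mass \<phi> + true_mass \<phi>) * S \<le> 1" by (simp add: mass_add[OF \<phi>])
  show "FDR \<pi>1 M f0 f1 n (tests_rule \<phi> n) \<le> false_mass \<phi> / (false_mass \<phi> + true_mass \<phi>)"
  proof (cases "false_mass \<phi> + true_mass \<phi> = 0")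
    case True
    then have "false_mass \<phi> = 0" using mass_nonneg[OF \<phi>] by linarith
    then show ?thesis by (simp add: fdr)
  next
    case False
    then have pos: "false_mass \<phi> + true_mass \<phi> > 0" using mass_nonneg[OF \<phi>] by linarith
    then have "S \<le> 1 / (false_mass \<phi> + true_mass \<phi>)" using * by (simp add: field_simps)
    from mult_left_mono[OF this mass_nonneg(1)[OF \<phi>]] show ?thesis
      by (simp add: fdr)
  qed
qed

end

section \<open>Reduction of an arbitrary rule to a test of one hypothesis\<close>

lemma measurable_fun_upd_obs:
  assumes "i < n"
  shows "(\<lambda>p. (snd p)(i := fst p)) \<in> M \<Otimes>\<^sub>M obs_space M n \<rightarrow>\<^sub>M obs_space M n"
proof -
  have "(\<lambda>p. (snd p)(i := fst p)) \<in> M \<Otimes>\<^sub>M obs_space M n \<rightarrow>\<^sub>M (\<Pi>\<^sub>M j\<in>insert i {..<n}. M)"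
    unfolding obs_space_def by (intro measurable_fun_upd[where J = "{..<n}"]) auto
  moreover have "insert i {..<n} = {..<n}" using assms by auto
  ultimately show ?thesis by (simp add: obs_space_def)
qed

lemma fun_upd_obs:
  "i < n \<Longrightarrow> x \<in> space (obs_space M n) \<Longrightarrow> z \<in> space M \<Longrightarrow> x(i := z) \<in> space (obs_space M n)"
  by (auto simp: obs_space_def space_PiM PiE_iff extensional_def)

context two_group
begin

text \<open>A rule for \<open>m\<close> hypotheses becomes a test for one: hide the observation
  among \<open>m - 1\<close> simulated ones, at a uniformly random position.\<close>

lemma ex_test_of_rule:
  assumes K: "decision_rule M m K" and m: "1 \<le> m"
  shows "\<exists>\<phi>. test \<phi> \<and> true_positives m K = m * true_mass \<phi> \<and> false_positives m K = m * false_mass \<phi>"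
proof -
  interpret P: prob_space "P m" by (rule prob_space_P)
  define k where "k j x = (\<integral>\<delta>. of_bool (\<delta> j) \<partial>K x :: real)" for j x
  define g where "g j z = (\<integral>x. k j (x(j := z)) \<partial>P m)" for j z
  define \<phi>0 where "\<phi>0 z = (\<Sum>j<m. g j z) / m" for z
  \<comment> \<open>Outside \<open>space M\<close> nothing bounds \<open>\<phi>0\<close> from above,
    while \<open>test\<close> asks for bounds everywhere; on \<open>space M\<close> the truncation
    changes nothing.\<close>
  define \<phi> where "\<phi> z = max 0 (min 1 (\<phi>0 z))" for z
  have k: "k j \<in> borel_measurable (obs_space M m)" "x \<in> space (obs_space M m) \<Longrightarrow> k j x \<le> 1" "0 \<le> k j x"
    for j x
    using integral_kernel_bounds[OF K, of "\<lambda>\<delta>. of_bool (\<delta> j)"] by (auto simp: k_def[abs_def])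
  have kupd: "(\<lambda>p. k j ((snd p)(j := fst p))) \<in> borel_measurable (M \<Otimes>\<^sub>M obs_space M m)" if "j < m" for j
    by (rule measurable_compose[OF measurable_fun_upd_obs[OF that] k(1)])
  have kz: "(\<lambda>x. k j (x(j := z))) \<in> borel_measurable (obs_space M m)" if "j < m" "z \<in> space M" for j z
    using measurable_compose[OF measurable_Pair1'[OF that(2)] kupd[OF that(1)]] by simp
  have gm: "g j \<in> borel_measurable M" if "j < m" for j
  proof -
    have s: "sets (M \<Otimes>\<^sub>M P m) = sets (M \<Otimes>\<^sub>M obs_space M m)"
      by (rule sets_pair_measure_cong) auto
    have "(\<lambda>(z, x). k j (x(j := z))) \<in> borel_measurable (M \<Otimes>\<^sub>M P m)"
      unfolding measurable_cong_sets[OF s refl] using kupd[OF that] by (simp add: case_prod_beta')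
    then show ?thesis unfolding g_def by (rule P.borel_measurable_lebesgue_integral)
  qed
  have gb: "0 \<le> g j z" "z \<in> space M \<Longrightarrow> g j z \<le> 1" if "j < m" for j z
  proof -
    show "0 \<le> g j z" unfolding g_def by (intro Bochner_Integration.integral_nonneg k)
    assume z: "z \<in> space M"
    have "g j z \<le> (\<integral>x. 1 \<partial>P m)"
      unfolding g_def
    proof (rule integral_mono)
      show "integrable (P m) (\<lambda>x. k j (x(j := z)))"
        by (rule integrable_P[where C = 1])
          (use that z k kz fun_upd_obs[OF that _ z] in auto)
    qed (use that z k fun_upd_obs[OF that _ z] in \<open>auto simp: sets_eq_imp_space_eq[OF sets_P]\<close>)
    then show "g j z \<le> 1" by (simp add: P.prob_space)
  qed
  have \<phi>eq: "\<phi> z = \<phi>0 z" if "z \<in> space M" for z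
  proof -
    have "0 \<le> (\<Sum>j<m. g j z)" by (intro sum_nonneg gb) auto
    moreover have "(\<Sum>j<m. g j z) \<le> (\<Sum>j<m. 1)" by (intro sum_mono gb) (use that in auto)
    ultimately show ?thesis using m by (simp add: \<phi>_def \<phi>0_def)
  qed
  have \<phi>: "test \<phi>"
    unfolding test_def
  proof
    show "\<phi> \<in> borel_measurable M"
      unfolding \<phi>_def \<phi>0_def
      by (intro borel_measurable_max borel_measurable_min borel_measurable_divide borel_measurable_sum gm) auto
  qed (auto simp: \<phi>_def)
  \<comment> \<open>Applied with \<open>w = eta\<close> and \<open>w = 1 - eta\<close>, so that the
    same test serves true and false positives.\<close>
  have *: "(\<integral>(x, \<delta>). (\<Sum>i<m. of_bool (\<delta> i) * w (x i)) \<partial>Q m K) = m * (\<integral>x. \<phi> x * w x \<partial>mu)"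
    if w[measurable]: "w \<in> borel_measurable M" and wb: "\<And>x. 0 \<le> w x" "\<And>x. w x \<le> 1" for w :: "'a \<Rightarrow> real"
  proof -
    have "(\<integral>(x, \<delta>). (\<Sum>i<m. of_bool (\<delta> i) * w (x i)) \<partial>Q m K) = (\<Sum>i<m. \<integral>x. w (x i) * k i x \<partial>P m)"
      unfolding k_def by (rule integral_Q_weighted[OF K w wb]) auto
    also have "\<dots> = (\<Sum>i<m. \<integral>z. w z * g i z \<partial>mu)"
    proof (rule sum.cong[OF refl])
      fix i assume i: "i \<in> {..<m}"
      have [measurable]: "(\<lambda>x. w (x i)) \<in> borel_measurable (obs_space M m)"
        using i by (intro measurable_compose[OF measurable_obs_coordinate w]) auto
      note [measurable] = k(1)
      \<comment> \<open>After resampling, \<open>z\<close> is the hidden observation and the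
        remaining coordinates of \<open>x\<close> are the simulated ones.\<close>
      have "(\<integral>x. w (x i) * k i x \<partial>P m) = (\<integral>z. (\<integral>x. w ((x(i := z)) i) * k i (x(i := z)) \<partial>P m) \<partial>mu)"
      proof (rule integral_PiM_resample[OF prob_space_mu i])
        show "integrable (P m) (\<lambda>x. w (x i) * k i x)"
          by (rule integrable_P[where C = 1]) (use wb k in \<open>auto simp: abs_mult intro!: mult_le_one\<close>)
      qed
      then show "(\<integral>x. w (x i) * k i x \<partial>P m) = (\<integral>z. w z * g i z \<partial>mu)"
        by (simp add: g_def)
    qed
    also have "\<dots> = (\<integral>z. (\<Sum>i<m. w z * g i z) \<partial>mu)"
    proof (rule Bochner_Integration.integral_sum[symmetric])
      fix i assume i: "i \<in> {..<m}"
      then have [measurable]: "g i \<in> borel_measurable M" using gm by simp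
      show "integrable mu (\<lambda>z. w z * g i z)"
        by (rule integrable_mu[where C = 1]) (use i wb gb in \<open>auto simp: abs_mult intro!: mult_le_one\<close>)
    qed
    also have "\<dots> = (\<integral>z. m * (\<phi> z * w z) \<partial>mu)"
    proof (rule Bochner_Integration.integral_cong[OF refl])
      fix z assume "z \<in> space mu"
      then show "(\<Sum>i<m. w z * g i z) = m * (\<phi> z * w z)"
        using m by (simp add: \<phi>eq \<phi>0_def sum_distrib_left[symmetric])
    qed
    finally show ?thesis by simp
  qed
  have "true_positives m K = m * true_mass \<phi>"
    unfolding true_positives_def true_mass_def
    by (rule *) (use measurable_weights eta_bounds in auto)
  moreover have "false_positives m K = m * false_mass \<phi>"
    unfolding false_positives_def false_mass_def
    by (rule *) (use measurable_weights eta_bounds in auto)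
  ultimately show ?thesis using \<phi> by blast
qed

text \<open>The factor \<open>m\<close> cancels in both rates. Together with
  \<open>tests_rule_rates\<close> this shows that the attainable pairs of mFDR and EFN are the same
  for every positive number of hypotheses.\<close>

lemma rule_rates:
  assumes K: "decision_rule M m K" and m: "1 \<le> m"
  obtains \<phi> where "test \<phi>" "EFN \<pi>1 M f0 f1 m K = \<pi>1 - true_mass \<phi>"
    "mFDR \<pi>1 M f0 f1 m K = false_mass \<phi> / (false_mass \<phi> + true_mass \<phi>)"
proof -
  obtain \<phi> where \<phi>: "test \<phi>" "true_positives m K = m * true_mass \<phi>" "false_positives m K = m * false_mass \<phi>"
    using ex_test_of_rule[OF K m] by blast
  have "EFN \<pi>1 M f0 f1 m K = \<pi>1 - true_mass \<phi>"
    using m by (simp add: EFN_eq[OF K] \<phi>)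
  moreover have "mFDR \<pi>1 M f0 f1 m K = false_mass \<phi> / (false_mass \<phi> + true_mass \<phi>)"
    using m unfolding mFDR_eq[OF K] \<phi> distrib_left[symmetric] by simp
  ultimately show ?thesis using that \<phi> by blast
qed

section \<open>Optimal values, their comparison and convexity\<close>

lemma EFN_nonneg: "0 \<le> EFN \<pi>1 M f0 f1 n K"
  unfolding EFN_def false_negatives_def
  by (intro mult_nonneg_nonneg Bochner_Integration.integral_nonneg) (auto intro: sum_nonneg)

lemma EFN_opt_le:
  "decision_rule M n K \<Longrightarrow> FDR \<pi>1 M f0 f1 n K \<le> \<alpha> \<Longrightarrow> EFN_opt \<pi>1 M f0 f1 n \<alpha> \<le> EFN \<pi>1 M f0 f1 n K"
  unfolding EFN_opt_def by (rule cInf_lower) (auto intro: bdd_belowI EFN_nonneg)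

lemma mEFN_opt_le:
  "decision_rule M n K \<Longrightarrow> mFDR \<pi>1 M f0 f1 n K \<le> \<alpha> \<Longrightarrow> mEFN_opt \<pi>1 M f0 f1 n \<alpha> \<le> EFN \<pi>1 M f0 f1 n K"
  unfolding mEFN_opt_def by (rule cInf_lower) (auto intro: bdd_belowI EFN_nonneg)

text \<open>Never rejecting makes both rates 0. This keeps the two infima over nonempty sets, as
  needed to bound them from below.\<close>

lemma ex_feasible_rule:
  assumes "0 \<le> \<alpha>" "1 \<le> n"
  shows "\<exists>K. decision_rule M n K \<and> FDR \<pi>1 M f0 f1 n K \<le> \<alpha> \<and> mFDR \<pi>1 M f0 f1 n K \<le> \<alpha>"
proof -
  have "test (\<lambda>_. 0)" by (simp add: test_def)
  from tests_rule_rates(2,3)[OF this assms(2)] decision_rule_tests_rule[OF this, of n] show ?thesis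
    using assms(1) by (intro exI[of _ "tests_rule (\<lambda>_. 0) n"]) (auto simp: false_mass_def)
qed

lemma EFN_opt_ge:
  assumes "0 \<le> \<alpha>" "1 \<le> n"
    and "\<And>K. decision_rule M n K \<Longrightarrow> FDR \<pi>1 M f0 f1 n K \<le> \<alpha> \<Longrightarrow> c \<le> EFN \<pi>1 M f0 f1 n K"
  shows "c \<le> EFN_opt \<pi>1 M f0 f1 n \<alpha>"
  unfolding EFN_opt_def
  by (rule cInf_greatest) (use ex_feasible_rule[OF assms(1,2)] assms(3) in auto)

lemma mEFN_opt_ge:
  assumes "0 \<le> \<alpha>" "1 \<le> n"
    and "\<And>K. decision_rule M n K \<Longrightarrow> mFDR \<pi>1 M f0 f1 n K \<le> \<alpha> \<Longrightarrow> c \<le> EFN \<pi>1 M f0 f1 n K"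
  shows "c \<le> mEFN_opt \<pi>1 M f0 f1 n \<alpha>"
  unfolding mEFN_opt_def
  by (rule cInf_greatest) (use ex_feasible_rule[OF assms(1,2)] assms(3) in auto)

lemma mEFN_opt_le_test:
  assumes "test \<phi>" "1 \<le> m" "false_mass \<phi> / (false_mass \<phi> + true_mass \<phi>) \<le> \<alpha>"
  shows "mEFN_opt \<pi>1 M f0 f1 m \<alpha> \<le> \<pi>1 - true_mass \<phi>"
  using mEFN_opt_le[OF decision_rule_tests_rule[OF assms(1)], of m \<alpha>] tests_rule_rates[OF assms(1,2)] assms(3)
  by simp

lemma EFN_opt_le_mEFN_opt:
  assumes "0 \<le> \<alpha>" "1 \<le> n" "1 \<le> m"
  shows "EFN_opt \<pi>1 M f0 f1 n \<alpha> \<le> mEFN_opt \<pi>1 M f0 f1 m \<alpha>"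
proof (rule mEFN_opt_ge[OF assms(1,3)])
  fix K assume K: "decision_rule M m K" and le: "mFDR \<pi>1 M f0 f1 m K \<le> \<alpha>"
  obtain \<phi> where \<phi>: "test \<phi>" "EFN \<pi>1 M f0 f1 m K = \<pi>1 - true_mass \<phi>"
    "mFDR \<pi>1 M f0 f1 m K = false_mass \<phi> / (false_mass \<phi> + true_mass \<phi>)"
    using rule_rates[OF K assms(3)] by blast
  have "EFN_opt \<pi>1 M f0 f1 n \<alpha> \<le> EFN \<pi>1 M f0 f1 n (tests_rule \<phi> n)"
    using tests_rule_rates(3)[OF \<phi>(1) assms(2)] le \<phi>(3)
    by (intro EFN_opt_le decision_rule_tests_rule[OF \<phi>(1)]) simp
  then show "EFN_opt \<pi>1 M f0 f1 n \<alpha> \<le> EFN \<pi>1 M f0 f1 m K"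
    using tests_rule_rates(1)[OF \<phi>(1) assms(2)] \<phi>(2) by simp
qed

text \<open>One coin selects the rule for the whole vector of decisions, so every expectation is
  affine in \<open>t\<close>. This covers FDR and EFN but not mFDR, which is a quotient of two
  expectations.\<close>

definition mixed_rule :: "real \<Rightarrow> ('b \<Rightarrow> 'c measure) \<Rightarrow> ('b \<Rightarrow> 'c measure) \<Rightarrow> 'b \<Rightarrow> 'c measure" where
  "mixed_rule t K1 K2 x = measure_pmf (bernoulli_pmf t) \<bind> (\<lambda>b. if b then K1 x else K2 x)"

lemma decision_rule_mixed_rule:
  assumes "decision_rule M n K1" "decision_rule M n K2"
  shows "decision_rule M n (mixed_rule t K1 K2)"
proof -
  have [measurable]: "K1 \<in> obs_space M n \<rightarrow>\<^sub>M prob_algebra (binary_space n)"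
    "K2 \<in> obs_space M n \<rightarrow>\<^sub>M prob_algebra (binary_space n)"
    using assms by (auto simp: decision_rule_def)
  have [measurable]: "(\<lambda>x. measure_pmf (bernoulli_pmf t)) \<in> obs_space M n \<rightarrow>\<^sub>M prob_algebra (count_space UNIV)"
    by (rule measurable_const) (auto simp: space_prob_algebra measure_pmf.prob_space_axioms)
  show ?thesis
    unfolding decision_rule_def mixed_rule_def by measurable
qed

lemma integral_Q_mixed_rule:
  assumes K1: "decision_rule M n K1" and K2: "decision_rule M n K2" and t: "0 \<le> t" "t \<le> 1"
    and F[measurable]: "F \<in> borel_measurable (obs_space M n \<Otimes>\<^sub>M binary_space n)"
    and C: "\<And>p. 0 \<le> F p" "\<And>p. F p \<le> (C :: real)"
  shows "(\<integral>p. F p \<partial>Q n (mixed_rule t K1 K2)) = t * (\<integral>p. F p \<partial>Q n K1) + (1 - t) * (\<integral>p. F p \<partial>Q n K2)"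
proof -
  have K: "decision_rule M n (mixed_rule t K1 K2)" by (rule decision_rule_mixed_rule[OF K1 K2])
  have fin: "(\<integral>\<^sup>+p. ennreal (F p) \<partial>Q n K) = ennreal (\<integral>p. F p \<partial>Q n K)" if "decision_rule M n K" for K
    using C by (intro nn_integral_eq_integral integrable_Q[OF that F, where C = C]) auto
  have int: "integrable (Q n K) F" if "decision_rule M n K" for K
    using C by (intro integrable_Q[OF that F, where C = C]) auto
  have "(\<integral>\<^sup>+p. ennreal (F p) \<partial>Q n (mixed_rule t K1 K2)) =
    (\<integral>\<^sup>+x. \<integral>\<^sup>+\<delta>. ennreal (F (x, \<delta>)) \<partial>mixed_rule t K1 K2 x \<partial>P n)"
    by (rule nn_integral_Q[OF K]) measurable
  also have "\<dots> = (\<integral>\<^sup>+x. ennreal t * (\<integral>\<^sup>+\<delta>. ennreal (F (x, \<delta>)) \<partial>K1 x) +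
      ennreal (1 - t) * (\<integral>\<^sup>+\<delta>. ennreal (F (x, \<delta>)) \<partial>K2 x) \<partial>P n)"
  proof (rule nn_integral_cong)
    fix x assume "x \<in> space (P n)"
    then have x: "x \<in> space (obs_space M n)" by (simp add: sets_eq_imp_space_eq[OF sets_P])
    have "(\<integral>\<^sup>+\<delta>. ennreal (F (x, \<delta>)) \<partial>mixed_rule t K1 K2 x) =
      (\<integral>\<^sup>+b. \<integral>\<^sup>+\<delta>. ennreal (F (x, \<delta>)) \<partial>(if b then K1 x else K2 x) \<partial>measure_pmf (bernoulli_pmf t))"
      unfolding mixed_rule_def
    proof (rule nn_integral_bind[where B = "binary_space n"])
      show "(\<lambda>\<delta>. ennreal (F (x, \<delta>))) \<in> borel_measurable (binary_space n)"
        by (rule measurable_from_binary_space)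
      show "(\<lambda>b. if b then K1 x else K2 x) \<in> measure_pmf (bernoulli_pmf t) \<rightarrow>\<^sub>M subprob_algebra (binary_space n)"
        using decision_ruleD[OF K1 x] decision_ruleD[OF K2 x]
        by (auto simp: measurable_def space_subprob_algebra prob_space_imp_subprob_space)
    qed
    also have "\<dots> = (\<integral>\<^sup>+\<delta>. ennreal (F (x, \<delta>)) \<partial>K1 x) * ennreal t +
        (\<integral>\<^sup>+\<delta>. ennreal (F (x, \<delta>)) \<partial>K2 x) * ennreal (1 - t)"
      using t by (subst nn_integral_measure_pmf_support[of UNIV]) (auto simp: UNIV_bool add.commute)
    finally show "(\<integral>\<^sup>+\<delta>. ennreal (F (x, \<delta>)) \<partial>mixed_rule t K1 K2 x) =
      ennreal t * (\<integral>\<^sup>+\<delta>. ennreal (F (x, \<delta>)) \<partial>K1 x) + ennreal (1 - t) * (\<integral>\<^sup>+\<delta>. ennreal (F (x, \<delta>)) \<partial>K2 x)"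
      by (simp add: mult.commute)
  qed
  also have "\<dots> = ennreal t * (\<integral>\<^sup>+x. \<integral>\<^sup>+\<delta>. ennreal (F (x, \<delta>)) \<partial>K1 x \<partial>P n) +
      ennreal (1 - t) * (\<integral>\<^sup>+x. \<integral>\<^sup>+\<delta>. ennreal (F (x, \<delta>)) \<partial>K2 x \<partial>P n)"
  proof -
    have [measurable]: "(\<lambda>x. \<integral>\<^sup>+\<delta>. ennreal (F (x, \<delta>)) \<partial>K x) \<in> borel_measurable (P n)" if "decision_rule M n K" for K
      unfolding measurable_cong_sets[OF sets_P refl]
      by (rule measurable_nn_kernel[OF that, where F = "\<lambda>p. ennreal (F p)"]) measurable
    show ?thesis
      using K1 K2 by (subst nn_integral_add) (auto simp: nn_integral_cmult)
  qed
  also have "\<dots> = ennreal t * (\<integral>\<^sup>+p. ennreal (F p) \<partial>Q n K1) + ennreal (1 - t) * (\<integral>\<^sup>+p. ennreal (F p) \<partial>Q n K2)"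
    by (subst (1 2) nn_integral_Q) (auto simp: K1 K2)
  finally have "ennreal (\<integral>p. F p \<partial>Q n (mixed_rule t K1 K2)) =
    ennreal (t * (\<integral>p. F p \<partial>Q n K1) + (1 - t) * (\<integral>p. F p \<partial>Q n K2))"
    using t C by (simp add: fin K K1 K2 ennreal_mult ennreal_plus Bochner_Integration.integral_nonneg)
  then show ?thesis
    using t C by (subst (asm) ennreal_inj) (auto intro!: add_nonneg_nonneg mult_nonneg_nonneg Bochner_Integration.integral_nonneg)
qed

lemma mixed_rule_rates:
  assumes K1: "decision_rule M n K1" and K2: "decision_rule M n K2" and t: "0 \<le> t" "t \<le> 1" and n: "1 \<le> n"
  shows "EFN \<pi>1 M f0 f1 n (mixed_rule t K1 K2) = t * EFN \<pi>1 M f0 f1 n K1 + (1 - t) * EFN \<pi>1 M f0 f1 n K2"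
    and "FDR \<pi>1 M f0 f1 n (mixed_rule t K1 K2) = t * FDR \<pi>1 M f0 f1 n K1 + (1 - t) * FDR \<pi>1 M f0 f1 n K2"
proof -
  have K: "decision_rule M n (mixed_rule t K1 K2)" by (rule decision_rule_mixed_rule[OF K1 K2])
  have b: "0 \<le> (\<Sum>i<n. of_bool (\<delta> i) * e (x i))" "(\<Sum>i<n. of_bool (\<delta> i) * e (x i)) \<le> rejections n \<delta>"
    "(\<Sum>i<n. of_bool (\<delta> i) * e (x i)) \<le> n"
    if "\<And>x. 0 \<le> e x" "\<And>x. e x \<le> 1" for \<delta> and e :: "'a \<Rightarrow> real" and x
  proof -
    show "0 \<le> (\<Sum>i<n. of_bool (\<delta> i) * e (x i))" using that by (intro sum_nonneg) auto
    show "(\<Sum>i<n. of_bool (\<delta> i) * e (x i)) \<le> rejections n \<delta>"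
      unfolding rejections_def using that by (intro sum_mono) auto
    have "(\<Sum>i<n. of_bool (\<delta> i) * e (x i)) \<le> (\<Sum>i<n. 1)" using that by (intro sum_mono) auto
    then show "(\<Sum>i<n. of_bool (\<delta> i) * e (x i)) \<le> n" by simp
  qed
  note b1 = b[of eta, OF eta_bounds] and b2 = b[of "\<lambda>x. 1 - eta x"]
  have tp: "true_positives n (mixed_rule t K1 K2) = t * true_positives n K1 + (1 - t) * true_positives n K2"
    unfolding true_positives_def
    by (rule integral_Q_mixed_rule[OF K1 K2 t, where C = n]) (measurable, auto intro: b1)
  show "EFN \<pi>1 M f0 f1 n (mixed_rule t K1 K2) = t * EFN \<pi>1 M f0 f1 n K1 + (1 - t) * EFN \<pi>1 M f0 f1 n K2"
    unfolding EFN_eq[OF K n] EFN_eq[OF K1 n] EFN_eq[OF K2 n] tp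
    using n by (simp add: field_simps)
  have [measurable]: "(\<lambda>\<delta>. max 1 (rejections n \<delta>)) \<in> borel_measurable (binary_space n)"
    by (rule measurable_from_binary_space)
  show "FDR \<pi>1 M f0 f1 n (mixed_rule t K1 K2) = t * FDR \<pi>1 M f0 f1 n K1 + (1 - t) * FDR \<pi>1 M f0 f1 n K2"
    unfolding FDR_eq[OF K] FDR_eq[OF K1] FDR_eq[OF K2]
  proof (rule integral_Q_mixed_rule[OF K1 K2 t, where C = 1])
    fix p :: "(nat \<Rightarrow> 'a) \<times> (nat \<Rightarrow> bool)"
    obtain x \<delta> where p: "p = (x, \<delta>)" by fastforce
    have e: "\<And>x. 0 \<le> 1 - eta x" "\<And>x. 1 - eta x \<le> 1" using eta_bounds by auto
    show "0 \<le> (case p of (x, \<delta>) \<Rightarrow> (\<Sum>i<n. of_bool (\<delta> i) * (1 - eta (x i))) / max 1 (rejections n \<delta>))"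
      using b2(1)[OF e, of \<delta> x] by (auto simp: p)
    show "(case p of (x, \<delta>) \<Rightarrow> (\<Sum>i<n. of_bool (\<delta> i) * (1 - eta (x i))) / max 1 (rejections n \<delta>)) \<le> 1"
      using b2(2)[OF e, of \<delta> x] by (auto simp: p divide_le_eq max_def)
  qed measurable
qed

lemma convex_EFN_opt:
  assumes n: "1 \<le> n"
  shows "convex_on {0..1} (EFN_opt \<pi>1 M f0 f1 n)"
proof (rule convex_onI)
  fix t x y :: real assume t: "0 < t" "t < 1" and xy: "x \<in> {0..1}" "y \<in> {0..1}"
  let ?E = "EFN_opt \<pi>1 M f0 f1 n"
  let ?z = "(1 - t) * x + t * y"
  \<comment> \<open>The two infima are taken one at a time: the inequality for the mixture is solved
    for the rate of \<open>K2\<close>, giving a bound on \<open>?E y\<close>, and afterwards for the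
    rate of \<open>K1\<close>.\<close>
  have "(?E ?z - (1 - t) * EFN \<pi>1 M f0 f1 n K1) / t \<le> ?E y"
    if K1: "decision_rule M n K1" "FDR \<pi>1 M f0 f1 n K1 \<le> x" for K1
  proof (rule EFN_opt_ge)
    fix K2 assume K2: "decision_rule M n K2" "FDR \<pi>1 M f0 f1 n K2 \<le> y"
    have r: "EFN \<pi>1 M f0 f1 n (mixed_rule t K2 K1) = t * EFN \<pi>1 M f0 f1 n K2 + (1 - t) * EFN \<pi>1 M f0 f1 n K1"
      "FDR \<pi>1 M f0 f1 n (mixed_rule t K2 K1) = t * FDR \<pi>1 M f0 f1 n K2 + (1 - t) * FDR \<pi>1 M f0 f1 n K1"
      using mixed_rule_rates[OF K2(1) K1(1) _ _ n, of t] t by auto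
    have "t * FDR \<pi>1 M f0 f1 n K2 \<le> t * y" "(1 - t) * FDR \<pi>1 M f0 f1 n K1 \<le> (1 - t) * x"
      using t K1 K2 by (auto intro!: mult_left_mono)
    then have "FDR \<pi>1 M f0 f1 n (mixed_rule t K2 K1) \<le> ?z" unfolding r by linarith
    then have "?E ?z \<le> EFN \<pi>1 M f0 f1 n (mixed_rule t K2 K1)"
      by (intro EFN_opt_le decision_rule_mixed_rule K1 K2)
    then show "(?E ?z - (1 - t) * EFN \<pi>1 M f0 f1 n K1) / t \<le> EFN \<pi>1 M f0 f1 n K2"
      using t r by (simp add: field_simps)
  qed (use xy n in auto)
  then have "(?E ?z - t * ?E y) / (1 - t) \<le> ?E x"
    using t xy n by (intro EFN_opt_ge) (auto simp: field_simps)
  then show "?E ((1 - t) *\<^sub>R x + t *\<^sub>R y) \<le> (1 - t) * ?E x + t * ?E y"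
    using t by (simp add: field_simps)
qed (rule convex_real_interval)

end

section \<open>Imitating a sample by a single test\<close>

text \<open>Here \<open>a\<close> and \<open>b\<close> are the false and true mass of the imitating
  test, \<open>A\<close> and \<open>B\<close> the false and true rejections of the sample per
  hypothesis, \<open>e\<close> is the imitation error, and \<open>u + s * r\<close> bounds the true
  mass of a test with false proportion \<open>r\<close>. If \<open>A + B \<le> \<epsilon>\<close>,
  then \<open>B\<close> itself is at most \<epsilon>. Otherwise the denominators exceed \<epsilon>,
  and replacing the false proportion of the test by that of the sample costs at most
  \<open>s * e / \<epsilon>\<close>.\<close>

lemma discretized_bound_arith:
  fixes a b A B e s u \<epsilon> :: real
  assumes ab: "0 \<le> a" "0 \<le> b" and AB: "0 \<le> A" "0 \<le> B" and le: "a + b \<le> A + B"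
    and B: "B \<le> b + e" and e: "0 \<le> e" and s: "0 \<le> s" and eps: "0 < \<epsilon>"
    and u: "0 \<le> u" and lin: "b \<le> u + s * (a / (a + b))"
  shows "B \<le> u + s * (A / (A + B)) + \<epsilon> + (1 + s / \<epsilon>) * e"
proof (cases "A + B \<le> \<epsilon>")
  case True
  have "0 \<le> s * (A / (A + B))" "0 \<le> (1 + s / \<epsilon>) * e"
    using AB s e eps by (auto intro!: mult_nonneg_nonneg divide_nonneg_nonneg add_nonneg_nonneg)
  then show ?thesis using True AB u by linarith
next
  case False
  then have P: "\<epsilon> < A + B" by simp
  have "a / (a + b) \<le> A / (A + B) + e / (A + B)"
  proof (cases "a + b = 0")
    case True
    then show ?thesis using AB e by simp
  next
    case False
    then have p: "0 < a + b" using ab by linarith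
    \<comment> \<open>The comparison is made for the true proportions: passing from
      \<open>A + B\<close> down to \<open>a + b\<close> can only increase the fraction with
      numerator \<open>b\<close>. No comparison of \<open>a\<close> with \<open>A\<close> is
      required.\<close>
    have "B / (A + B) \<le> (b + e) / (A + B)"
      using B P eps by (intro divide_right_mono) auto
    also have "\<dots> \<le> b / (a + b) + e / (A + B)"
      unfolding add_divide_distrib using p le ab by (intro add_right_mono divide_left_mono) (auto intro: mult_pos_pos)
    finally have "B / (A + B) \<le> b / (a + b) + e / (A + B)" .
    moreover have "a / (a + b) = 1 - b / (a + b)" using p by (simp add: field_simps)
    moreover have "A / (A + B) = 1 - B / (A + B)" using P eps by (simp add: field_simps)
    ultimately show ?thesis by linarith
  qed
  also have "\<dots> \<le> A / (A + B) + e / \<epsilon>"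
    using P eps e by (intro add_left_mono divide_left_mono) auto
  finally have "s * (a / (a + b)) \<le> s * (A / (A + B) + e / \<epsilon>)"
    using s by (rule mult_left_mono)
  then have "B \<le> u + s * (A / (A + B)) + s * (e / \<epsilon>) + e"
    using lin B by (simp add: algebra_simps)
  then show ?thesis using eps by (simp add: algebra_simps)
qed

section \<open>Concentration of the bin frequencies and the bound for a fixed sample\<close>

context two_group
begin

lemma measure_mu_space [simp]: "measure mu (space M) = 1"
  using mu.prob_space by simp

text \<open>The second moment method: the centred variables \<open>y (x i)\<close> are bounded by 1
  and uncorrelated, so their sum \<open>W\<close> has second moment at most
  \<open>n\<close>.\<close>

lemma mean_deviation:
  fixes v :: "'a \<Rightarrow> real"
  assumes v[measurable]: "v \<in> borel_measurable M" and vb: "\<And>x. 0 \<le> v x" "\<And>x. v x \<le> 1" and n: "1 \<le> n"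
  shows "(\<integral>x. \<bar>(\<Sum>i<n. v (x i)) / n - (\<integral>z. v z \<partial>mu)\<bar> \<partial>P n) \<le> 1 / sqrt n"
proof -
  interpret P: prob_space "P n" by (rule prob_space_P)
  define p where "p = (\<integral>z. v z \<partial>mu)"
  have vi: "integrable mu v" by (rule integrable_mu[where C = 1]) (use vb in auto)
  have p: "0 \<le> p" "p \<le> 1"
  proof -
    show "0 \<le> p" unfolding p_def by (rule Bochner_Integration.integral_nonneg) (rule vb)
    have "p \<le> (\<integral>z. 1 \<partial>mu)" unfolding p_def by (rule integral_mono[OF vi]) (use vb in auto)
    then show "p \<le> 1" by (simp add: mu.prob_space)
  qed
  define y where "y x = v x - p" for x
  have yb: "\<bar>y x\<bar> \<le> 1" for x using vb[of x] p by (auto simp: y_def)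
  have y0: "(\<integral>z. y z \<partial>mu) = 0"
    unfolding y_def using vi by (subst Bochner_Integration.integral_diff) (auto simp: p_def mu.prob_space)
  have [measurable]: "(\<lambda>x. y (x i)) \<in> borel_measurable (obs_space M n)" if "i < n" for i
    using that unfolding y_def
    by (intro borel_measurable_diff measurable_compose[OF measurable_obs_coordinate v]) auto
  have yy: "integrable (P n) (\<lambda>x. y (x i) * y (x j))" if "i < n" "j < n" for i j
    by (rule integrable_P[where C = 1]) (use that yb in \<open>auto simp: abs_mult intro!: mult_le_one\<close>)
  define W where "W x = (\<Sum>i<n. y (x i))" for x
  have "(\<integral>x. (W x)\<^sup>2 \<partial>P n) = (\<integral>x. (\<Sum>i<n. \<Sum>j<n. y (x i) * y (x j)) \<partial>P n)"
    by (simp add: W_def power2_eq_square sum_product)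
  also have "\<dots> = (\<Sum>i<n. \<integral>x. (\<Sum>j<n. y (x i) * y (x j)) \<partial>P n)"
    by (rule Bochner_Integration.integral_sum)
      (use yy in \<open>auto intro!: Bochner_Integration.integrable_sum\<close>)
  also have "\<dots> = (\<Sum>i<n. \<Sum>j<n. \<integral>x. y (x i) * y (x j) \<partial>P n)"
    by (intro sum.cong refl Bochner_Integration.integral_sum) (use yy in auto)
  also have "\<dots> \<le> (\<Sum>i<n. \<Sum>j<n. if i = j then 1 else 0)"
  proof (intro sum_mono)
    fix i j assume ij: "i \<in> {..<n}" "j \<in> {..<n}"
    show "(\<integral>x. y (x i) * y (x j) \<partial>P n) \<le> (if i = j then 1 else 0)"
    proof (cases "i = j")
      case True
      have "(\<integral>x. y (x i) * y (x j) \<partial>P n) \<le> (\<integral>x. 1 \<partial>P n)"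
      proof (rule integral_mono)
        fix x show "y (x i) * y (x j) \<le> 1"
          using mult_le_one[OF yb[of "x i"] abs_ge_zero yb[of "x j"]] abs_le_D1 by (simp add: abs_mult[symmetric])
      qed (use ij yy in auto)
      then show ?thesis using True by (simp add: P.prob_space)
    next
      case False
      have "(\<integral>x. y (x i) * y (x j) \<partial>P n) = (\<integral>z. y z \<partial>mu) * (\<integral>x. y (x j) \<partial>P n)"
        by (rule integral_PiM_mult_coordinate) (use False ij yy prob_space_mu in auto)
      then show ?thesis using False y0 by simp
    qed
  qed
  also have "\<dots> = n" by simp
  finally have W2: "(\<integral>x. (W x)\<^sup>2 \<partial>P n) \<le> n" .
  have W2i: "integrable (P n) (\<lambda>x. (W x)\<^sup>2)"
    unfolding W_def power2_eq_square sum_product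
    by (intro Bochner_Integration.integrable_sum yy) auto
  have sq: "sqrt n > 0" using n by simp
  have dev: "\<bar>(\<Sum>i<n. v (x i)) / n - p\<bar> = \<bar>W x\<bar> / n" for x
  proof -
    have "(\<Sum>i<n. v (x i)) / n - p = W x / n"
      using n by (simp add: W_def y_def sum_subtractf field_simps)
    then show ?thesis by simp
  qed
  \<comment> \<open>From \<open>2 * \<bar>W x\<bar> * sqrt n \<le> (W x)\<^sup>2 + n\<close>. This
    takes the place of the Cauchy-Schwarz inequality; after integration each of the two summands
    contributes at most \<open>1 / (2 * sqrt n)\<close>.\<close>
  have amgm: "\<bar>W x\<bar> / n \<le> ((W x)\<^sup>2 / n + 1) / (2 * sqrt n)" for x
  proof -
    have "0 \<le> (\<bar>W x\<bar> - sqrt n)\<^sup>2" by simp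
    then have "2 * \<bar>W x\<bar> * sqrt n \<le> (W x)\<^sup>2 + n"
      by (simp add: power2_diff)
    then have "\<bar>W x\<bar> \<le> ((W x)\<^sup>2 + n) / (2 * sqrt n)"
      using sq by (simp add: pos_le_divide_eq mult.commute mult.left_commute)
    then have "\<bar>W x\<bar> / n \<le> ((W x)\<^sup>2 + n) / (2 * sqrt n) / n"
      by (rule divide_right_mono) simp
    also have "\<dots> = ((W x)\<^sup>2 / n + 1) / (2 * sqrt n)"
      using n sq by (simp add: divide_simps)
    finally show ?thesis .
  qed
  have "(\<integral>x. \<bar>(\<Sum>i<n. v (x i)) / n - p\<bar> \<partial>P n) \<le> (\<integral>x. ((W x)\<^sup>2 / n + 1) / (2 * sqrt n) \<partial>P n)"
  proof (rule integral_mono)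
    show "integrable (P n) (\<lambda>x. \<bar>(\<Sum>i<n. v (x i)) / n - p\<bar>)"
    proof (rule integrable_P[where C = 1])
      have [measurable]: "(\<lambda>x. v (x i)) \<in> borel_measurable (obs_space M n)" if "i < n" for i
        using that by (intro measurable_compose[OF measurable_obs_coordinate v]) auto
      show "(\<lambda>x. \<bar>(\<Sum>i<n. v (x i)) / n - p\<bar>) \<in> borel_measurable (obs_space M n)" by measurable
      fix x
      have "\<bar>W x\<bar> \<le> (\<Sum>i<n. \<bar>y (x i)\<bar>)" unfolding W_def by (rule sum_abs)
      also have "\<dots> \<le> (\<Sum>i<n. 1)" by (rule sum_mono) (rule yb)
      finally show "\<bar>\<bar>(\<Sum>i<n. v (x i)) / n - p\<bar>\<bar> \<le> 1"
        using n unfolding dev by simp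
    qed
    show "integrable (P n) (\<lambda>x. ((W x)\<^sup>2 / n + 1) / (2 * sqrt n))"
      using W2i by auto
  qed (use amgm in \<open>simp add: dev\<close>)
  also have "\<dots> = ((\<integral>x. (W x)\<^sup>2 \<partial>P n) / n + 1) / (2 * sqrt n)"
    using W2i by (simp add: P.prob_space)
  also have "\<dots> \<le> (1 + 1) / (2 * sqrt n)"
    using W2 n by (intro divide_right_mono add_right_mono) auto
  finally show ?thesis by (simp add: p_def)
qed

text \<open>For positive \<open>N\<close> there are \<open>N + 1\<close> bins, because the value 1
  of \<open>eta\<close> has the bin \<open>N\<close> to itself; hence the sums over
  \<open>j \<le> N\<close>.\<close>

definition bin :: "nat \<Rightarrow> 'a \<Rightarrow> nat" where "bin N z = nat \<lfloor>N * eta z\<rfloor>"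

lemma bin_bounds:
  assumes "1 \<le> N"
  shows "bin N z \<le> N" "real (bin N z) / N \<le> eta z" "eta z \<le> real (bin N z) / N + 1 / N"
proof -
  have e: "0 \<le> N * eta z" "N * eta z \<le> N" using eta_bounds[of z] assms by auto
  then have f: "0 \<le> \<lfloor>N * eta z\<rfloor>" "\<lfloor>N * eta z\<rfloor> \<le> N" by (auto simp: floor_le_iff)
  then show "bin N z \<le> N" by (simp add: bin_def)
  have r: "real (bin N z) = \<lfloor>N * eta z\<rfloor>" using f by (simp add: bin_def)
  have "real (bin N z) \<le> N * eta z" "N * eta z \<le> real (bin N z) + 1" unfolding r by linarith+
  then show "real (bin N z) / N \<le> eta z" "eta z \<le> real (bin N z) / N + 1 / N"
    using assms by (auto simp: field_simps)
qed

lemma measurable_bin [measurable]: "bin N \<in> M \<rightarrow>\<^sub>M count_space UNIV"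
proof -
  note [measurable] = measurable_eta_M
  show ?thesis unfolding bin_def by measurable
qed

definition bin_mass :: "nat \<Rightarrow> nat \<Rightarrow> real" where
  "bin_mass N j = (\<integral>z. of_bool (bin N z = j) \<partial>mu)"

text \<open>The l1 distance between the empirical distribution of the bins and their law under
  \<open>mu\<close>.\<close>

definition bin_deviation :: "nat \<Rightarrow> nat \<Rightarrow> (nat \<Rightarrow> 'a) \<Rightarrow> real" where
  "bin_deviation N n x = (\<Sum>j\<le>N. \<bar>(\<Sum>i<n. of_bool (bin N (x i) = j)) / n - bin_mass N j\<bar>)"

lemma bin_mass_nonneg: "0 \<le> bin_mass N j"
  unfolding bin_mass_def by (rule Bochner_Integration.integral_nonneg) simp

lemma sum_bin:
  fixes c :: "nat \<Rightarrow> real"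
  assumes "1 \<le> N"
  shows "(\<Sum>j\<le>N. c j * of_bool (bin N z = j)) = c (bin N z)"
proof -
  have "(\<Sum>j\<le>N. c j * of_bool (bin N z = j)) = (\<Sum>j\<le>N. if bin N z = j then c j else 0)"
    by (intro sum.cong) auto
  also have "\<dots> = c (bin N z)" using bin_bounds(1)[OF assms, of z] by (simp add: sum.delta')
  finally show ?thesis .
qed

lemma integral_bin:
  fixes c :: "nat \<Rightarrow> real"
  assumes N: "1 \<le> N"
  shows "(\<integral>z. c (bin N z) \<partial>mu) = (\<Sum>j\<le>N. c j * bin_mass N j)"
    and "integrable mu (\<lambda>z. c (bin N z))"
proof -
  have eq: "c (bin N z) = (\<Sum>j\<le>N. c j * of_bool (bin N z = j))" for z
    by (rule sum_bin[OF N, symmetric])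
  have i: "integrable mu (\<lambda>z. of_bool (bin N z = j) :: real)" for j
    by (rule integrable_mu[where C = 1]) auto
  show "integrable mu (\<lambda>z. c (bin N z))" unfolding eq using i by auto
  show "(\<integral>z. c (bin N z) \<partial>mu) = (\<Sum>j\<le>N. c j * bin_mass N j)"
    unfolding eq bin_mass_def using i by simp
qed

text \<open>The test rejects in each bin the same fraction as \<open>\<delta>\<close>, truncated so as to be a probability.\<close>

lemma ex_test_of_sample:
  fixes x :: "nat \<Rightarrow> 'a" and \<delta> :: "nat \<Rightarrow> bool"
  assumes N: "1 \<le> N" and n: "1 \<le> n"
  shows "\<exists>\<phi>. test \<phi> \<and> false_mass \<phi> + true_mass \<phi> \<le> rejections n \<delta> / n \<and>
    (\<Sum>i<n. of_bool (\<delta> i) * eta (x i)) / n \<le> true_mass \<phi> + (1 / N + bin_deviation N n x)"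
proof -
  define q where "q j = (\<Sum>i<n. of_bool (\<delta> i) * of_bool (bin N (x i) = j)) / real n" for j
  define p where "p = bin_mass N"
  \<comment> \<open>In a bin of mass 0 the quotient is 0 by the convention for division, which keeps
    \<open>coefp\<close> and \<open>coefb\<close> valid there.\<close>
  define coef where "coef j = min (q j) (p j) / p j" for j
  define \<phi> where "\<phi> z = coef (bin N z)" for z
  have q0: "0 \<le> q j" for j unfolding q_def by (intro divide_nonneg_nonneg sum_nonneg) auto
  have p0: "0 \<le> p j" for j by (simp add: p_def bin_mass_nonneg)
  have coefp: "coef j * p j = min (q j) (p j)" for j
    using q0[of j] p0[of j] by (cases "p j = 0") (auto simp: coef_def)
  have coefb: "0 \<le> coef j" "coef j \<le> 1" for j
    using q0[of j] p0[of j] by (auto simp: coef_def divide_le_eq_1)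
  have \<phi>: "test \<phi>"
    unfolding test_def
  proof
    show "\<phi> \<in> borel_measurable M"
      unfolding \<phi>_def by (rule measurable_compose[OF measurable_bin]) simp
  qed (auto simp: \<phi>_def coefb)
  \<comment> \<open>Weighting the bins by \<open>q\<close> amounts to summing over the rejected
    hypotheses. This is the passage between sample and bins in both directions.\<close>
  have qsum: "(\<Sum>j\<le>N. c j * q j) = (\<Sum>i<n. of_bool (\<delta> i) * c (bin N (x i))) / n" for c :: "nat \<Rightarrow> real"
  proof -
    have "(\<Sum>j\<le>N. c j * q j) = (\<Sum>j\<le>N. \<Sum>i<n. of_bool (\<delta> i) * (c j * of_bool (bin N (x i) = j))) / n"
      unfolding q_def by (simp add: sum_divide_distrib sum_distrib_left mult_ac)
    also have "(\<Sum>j\<le>N. \<Sum>i<n. of_bool (\<delta> i) * (c j * of_bool (bin N (x i) = j))) =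
        (\<Sum>i<n. of_bool (\<delta> i) * (\<Sum>j\<le>N. c j * of_bool (bin N (x i) = j)))"
      by (subst sum.swap) (simp add: sum_distrib_left)
    finally show ?thesis by (simp add: sum_bin[OF N])
  qed
  have q1: "(\<Sum>j\<le>N. q j) = rejections n \<delta> / n"
    using qsum[of "\<lambda>_. 1"] by (simp add: rejections_def)
  have "false_mass \<phi> + true_mass \<phi> = (\<Sum>j\<le>N. coef j * p j)"
    unfolding mass_add[OF \<phi>] \<phi>_def p_def by (rule integral_bin[OF N])
  also have "\<dots> \<le> (\<Sum>j\<le>N. q j)" by (rule sum_mono) (simp add: coefp)
  finally have 1: "false_mass \<phi> + true_mass \<phi> \<le> rejections n \<delta> / n" by (simp add: q1)
  \<comment> \<open>Posterior probabilities are rounded up here and back down in the comparison with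
    \<open>true_mass\<close>. The gap of \<open>1 / N\<close> is paid once, since the
    \<open>q j\<close> add up to at most 1.\<close>
  have "(\<Sum>i<n. of_bool (\<delta> i) * eta (x i)) / n \<le>
      (\<Sum>i<n. of_bool (\<delta> i) * (real (bin N (x i)) / N + 1 / N)) / n"
    by (intro divide_right_mono sum_mono mult_left_mono bin_bounds[OF N]) auto
  also have "\<dots> = (\<Sum>j\<le>N. (real j / N + 1 / N) * q j)" by (rule qsum[symmetric])
  also have "\<dots> = (\<Sum>j\<le>N. real j / N * q j) + 1 / N * (\<Sum>j\<le>N. q j)"
    by (simp add: distrib_right sum.distrib sum_distrib_left)
  also have "\<dots> \<le> (\<Sum>j\<le>N. real j / N * q j) + 1 / N"
  proof -
    have "rejections n \<delta> \<le> (\<Sum>i<n. 1)" unfolding rejections_def by (rule sum_mono) simp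
    then have "(\<Sum>j\<le>N. q j) \<le> 1" using n by (simp add: q1)
    then show ?thesis using N by (simp add: divide_right_mono)
  qed
  \<comment> \<open>The part of \<open>q j\<close> removed by the truncation is at most the excess
    of the empirical frequency of the bin over its mass, because \<open>q j\<close> cannot exceed
    that frequency.\<close>
  also have "(\<Sum>j\<le>N. real j / N * q j) \<le> (\<Sum>j\<le>N. real j / N * min (q j) (p j) +
      \<bar>(\<Sum>i<n. of_bool (bin N (x i) = j)) / n - p j\<bar>)"
  proof (rule sum_mono)
    fix j assume j: "j \<in> {..N}"
    let ?D = "\<bar>(\<Sum>i<n. of_bool (bin N (x i) = j)) / n - p j\<bar>"
    have "q j \<le> (\<Sum>i<n. of_bool (bin N (x i) = j)) / n"
      unfolding q_def by (intro divide_right_mono sum_mono) auto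
    then have d: "q j - min (q j) (p j) \<le> ?D" by (auto simp: min_def)
    have "real j / N * (q j - min (q j) (p j)) \<le> 1 * (q j - min (q j) (p j))"
      using j N by (intro mult_right_mono) auto
    then show "real j / N * q j \<le> real j / N * min (q j) (p j) + ?D"
      using d by (simp add: right_diff_distrib)
  qed
  also have "\<dots> = (\<Sum>j\<le>N. (real j / N * coef j) * p j) + bin_deviation N n x"
    unfolding sum.distrib bin_deviation_def p_def[symmetric] mult.assoc coefp ..
  also have "(\<Sum>j\<le>N. (real j / N * coef j) * p j) = (\<integral>z. real (bin N z) / N * coef (bin N z) \<partial>mu)"
    unfolding p_def by (rule integral_bin(1)[OF N, symmetric])
  also have "\<dots> \<le> true_mass \<phi>"
    unfolding true_mass_def
  proof (rule integral_mono[OF integral_bin(2)[OF N]])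
    note [measurable] = measurable_eta_M
    have [measurable]: "\<phi> \<in> borel_measurable M" using \<phi> by (simp add: test_def)
    show "integrable mu (\<lambda>z. \<phi> z * eta z)"
      by (rule integrable_mu[where C = 1])
        (use \<phi> eta_bounds in \<open>auto simp: test_def abs_mult intro!: mult_le_one\<close>)
    fix z show "real (bin N z) / N * coef (bin N z) \<le> \<phi> z * eta z"
      using mult_right_mono[OF bin_bounds(2)[OF N, of z] coefb(1)[of "bin N z"]]
      by (simp add: \<phi>_def mult.commute)
  qed
  finally have "(\<Sum>i<n. of_bool (\<delta> i) * eta (x i)) / n \<le> true_mass \<phi> + (1 / N + bin_deviation N n x)"
    by simp
  with 1 \<phi> show ?thesis by blast
qed

lemma bin_deviation_nonneg: "0 \<le> bin_deviation N n x"
  unfolding bin_deviation_def by (rule sum_nonneg) simp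

text \<open>Without rejections the numerator vanishes as well, so the maximum is absorbed by the
  convention for 0/0.\<close>

lemma FDP_eq:
  "(\<Sum>i<n. of_bool (\<delta> i) * w i) / max 1 (rejections n \<delta>) = (\<Sum>i<n. of_bool (\<delta> i) * w i) / rejections n \<delta>"
proof (cases "\<exists>i<n. \<delta> i")
  case True
  then obtain i where i: "i < n" "\<delta> i" by blast
  have "of_bool (\<delta> i) \<le> rejections n \<delta>"
    unfolding rejections_def by (rule member_le_sum) (use i in auto)
  then show ?thesis using i by (simp add: max_def)
next
  case False
  then have "(\<Sum>i<n. of_bool (\<delta> i) * w i) = 0" by (intro sum.neutral) auto
  then show ?thesis by simp
qed

text \<open>Assumption \<open>lin\<close> says that every test lies on or above the line with
  intercept \<open>c\<close> and slope \<open>-s\<close> in the plane of mFDR and EFN. The imitating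
  test carries this over to a single sample and decision vector, the false discovery proportion
  taking the place of the mFDR.\<close>

lemma discoveries_le:
  fixes x :: "nat \<Rightarrow> 'a"
  assumes N: "1 \<le> N" and n: "1 \<le> n" and s: "0 \<le> s" and eps: "0 < \<epsilon>"
    and lin: "\<And>\<phi>. test \<phi> \<Longrightarrow> c - s * (false_mass \<phi> / (false_mass \<phi> + true_mass \<phi>)) \<le> \<pi>1 - true_mass \<phi>"
  shows "(\<Sum>i<n. of_bool (\<delta> i) * eta (x i)) / n \<le> \<pi>1 - c +
    s * ((\<Sum>i<n. of_bool (\<delta> i) * (1 - eta (x i))) / max 1 (rejections n \<delta>)) + \<epsilon> +
    (1 + s / \<epsilon>) * (1 / N + bin_deviation N n x)"
proof -
  define A where "A = (\<Sum>i<n. of_bool (\<delta> i) * (1 - eta (x i))) / n"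
  define B where "B = (\<Sum>i<n. of_bool (\<delta> i) * eta (x i)) / n"
  have AB: "A + B = rejections n \<delta> / n"
    unfolding A_def B_def rejections_def add_divide_distrib[symmetric] sum.distrib[symmetric]
    by (simp add: algebra_simps)
  have AB0: "0 \<le> A" "0 \<le> B"
    unfolding A_def B_def using eta_bounds by (auto intro!: divide_nonneg_nonneg sum_nonneg)
  have FDP: "A / (A + B) = (\<Sum>i<n. of_bool (\<delta> i) * (1 - eta (x i))) / max 1 (rejections n \<delta>)"
    unfolding AB FDP_eq using n by (simp add: A_def)
  obtain \<phi> where \<phi>: "test \<phi>" "false_mass \<phi> + true_mass \<phi> \<le> rejections n \<delta> / n"
    "B \<le> true_mass \<phi> + (1 / N + bin_deviation N n x)"
    using ex_test_of_sample[OF N n, of \<delta> x] by (auto simp: B_def)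
  have t0: "test (\<lambda>_. 0)" by (simp add: test_def)
  have "B \<le> (\<pi>1 - c) + s * (A / (A + B)) + \<epsilon> + (1 + s / \<epsilon>) * (1 / N + bin_deviation N n x)"
  proof (rule discretized_bound_arith[where a = "false_mass \<phi>" and b = "true_mass \<phi>"])
    \<comment> \<open>The test that never rejects has mFDR 0 and EFN \<open>\<pi>1\<close>, so the
      intercept is at most \<open>\<pi>1\<close>.\<close>
    show "0 \<le> \<pi>1 - c" using lin[OF t0] by (simp add: false_mass_def true_mass_def)
    show "true_mass \<phi> \<le> \<pi>1 - c + s * (false_mass \<phi> / (false_mass \<phi> + true_mass \<phi>))"
      using lin[OF \<phi>(1)] by simp
    show "0 \<le> 1 / N + bin_deviation N n x" using bin_deviation_nonneg[of N n x] by simp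
  qed (use \<phi> AB AB0 s eps mass_nonneg[OF \<phi>(1)] in auto)
  then show ?thesis unfolding FDP unfolding B_def .
qed

lemma bin_deviation_bounded:
  shows "bin_deviation N n \<in> borel_measurable (obs_space M n)"
    and "bin_deviation N n x \<le> real (Suc N)"
proof -
  have [measurable]: "(\<lambda>x. bin N (x i)) \<in> obs_space M n \<rightarrow>\<^sub>M count_space UNIV" if "i < n" for i
    by (rule measurable_compose[OF measurable_obs_coordinate[OF that] measurable_bin])
  show "bin_deviation N n \<in> borel_measurable (obs_space M n)"
    unfolding bin_deviation_def[abs_def] by measurable
  have "bin_deviation N n x \<le> (\<Sum>j\<le>N. 1)"
    unfolding bin_deviation_def
  proof (rule sum_mono)
    fix j
    have "(\<Sum>i<n. of_bool (bin N (x i) = j)) \<le> (\<Sum>i<n. (1 :: real))" by (rule sum_mono) simp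
    then have "(\<Sum>i<n. of_bool (bin N (x i) = j)) / real n \<le> 1" by (cases "n = 0") auto
    moreover have "(0 :: real) \<le> (\<Sum>i<n. of_bool (bin N (x i) = j)) / real n"
      by (intro divide_nonneg_nonneg sum_nonneg) auto
    moreover have "bin_mass N j \<le> (\<integral>z. 1 \<partial>mu)"
      unfolding bin_mass_def
      by (rule integral_mono) (auto intro!: integrable_mu[where C = 1])
    ultimately show "\<bar>(\<Sum>i<n. of_bool (bin N (x i) = j)) / real n - bin_mass N j\<bar> \<le> 1"
      using bin_mass_nonneg[of N j] by (simp add: mu.prob_space)
  qed
  then show "bin_deviation N n x \<le> real (Suc N)" by simp
qed

lemma mean_bin_deviation:
  assumes n: "1 \<le> n"
  shows "(\<integral>x. bin_deviation N n x \<partial>P n) \<le> (N + 1) / sqrt n"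
proof -
  have [measurable]: "(\<lambda>x. bin N (x i)) \<in> obs_space M n \<rightarrow>\<^sub>M count_space UNIV" if "i < n" for i
    by (rule measurable_compose[OF measurable_obs_coordinate[OF that] measurable_bin])
  have "integrable (P n) (\<lambda>x. \<bar>(\<Sum>i<n. of_bool (bin N (x i) = j)) / n - bin_mass N j\<bar>)" if j: "j \<le> N" for j
  proof (rule integrable_P[where C = "real (Suc N)"])
    fix x
    have "\<bar>(\<Sum>i<n. of_bool (bin N (x i) = j)) / n - bin_mass N j\<bar> \<le> bin_deviation N n x"
      unfolding bin_deviation_def
      by (rule member_le_sum[where f = "\<lambda>j. \<bar>(\<Sum>i<n. of_bool (bin N (x i) = j)) / n - bin_mass N j\<bar>"])
        (use j in auto)
    then show "\<bar>\<bar>(\<Sum>i<n. of_bool (bin N (x i) = j)) / n - bin_mass N j\<bar>\<bar> \<le> real (Suc N)"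
      using bin_deviation_bounded(2)[of N n x] by simp
  qed measurable
  then have "(\<integral>x. bin_deviation N n x \<partial>P n) =
      (\<Sum>j\<le>N. \<integral>x. \<bar>(\<Sum>i<n. of_bool (bin N (x i) = j)) / n - bin_mass N j\<bar> \<partial>P n)"
    unfolding bin_deviation_def by (intro Bochner_Integration.integral_sum) auto
  also have "\<dots> \<le> (\<Sum>j\<le>N. 1 / sqrt n)"
    unfolding bin_mass_def by (intro sum_mono mean_deviation n) auto
  finally show ?thesis by (simp add: add.commute)
qed

lemma integrable_FDP:
  assumes K: "decision_rule M n K"
  shows "integrable (Q n K) (\<lambda>(x, \<delta>). (\<Sum>i<n. of_bool (\<delta> i) * (1 - eta (x i))) / max 1 (rejections n \<delta>))"
    (is "integrable _ ?F")
proof (rule integrable_Q[OF K, where C = n])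
  have [measurable]: "(\<lambda>\<delta>. max 1 (rejections n \<delta>)) \<in> borel_measurable (binary_space n)"
    by (rule measurable_from_binary_space)
  show "?F \<in> borel_measurable (obs_space M n \<Otimes>\<^sub>M binary_space n)" by measurable
  fix p :: "(nat \<Rightarrow> 'a) \<times> (nat \<Rightarrow> bool)"
  have "\<bar>\<Sum>i<n. of_bool (snd p i) * (1 - eta (fst p i))\<bar> \<le> n"
    by (rule abs_sum_unit_le) (use eta_bounds in auto)
  moreover have "\<bar>a / max 1 b\<bar> \<le> \<bar>a\<bar>" for a b :: real
    by (simp add: abs_divide max_def divide_le_eq mult_le_cancel_left1)
  ultimately show "\<bar>?F p\<bar> \<le> n" by (simp add: case_prod_beta') (meson order_trans)
qed

text \<open>The error terms have separate sources: \<epsilon> from samples with few rejections,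
  \<open>1 / N\<close> from rounding within bins, and \<open>(N + 1) / sqrt n\<close> from the
  deviation of the \<open>N + 1\<close> bin frequencies. \<epsilon> and \<open>N\<close> remain
  free, to be fixed before \<open>n\<close> grows.\<close>

lemma EFN_lower_bound:
  fixes N :: nat
  assumes K: "decision_rule M n K" and N: "1 \<le> N" and n: "1 \<le> n" and s: "0 \<le> s" and eps: "0 < \<epsilon>"
    and lin: "\<And>\<phi>. test \<phi> \<Longrightarrow> c - s * (false_mass \<phi> / (false_mass \<phi> + true_mass \<phi>)) \<le> \<pi>1 - true_mass \<phi>"
  shows "c - s * FDR \<pi>1 M f0 f1 n K - \<epsilon> - (1 + s / \<epsilon>) * (1 / N + (N + 1) / sqrt n) \<le> EFN \<pi>1 M f0 f1 n K"
proof -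
  interpret Q: prob_space "Q n K" by (rule prob_space_Q[OF K])
  let ?B = "\<lambda>(x, \<delta>). (\<Sum>i<n. of_bool (\<delta> i) * eta (x i))"
  let ?F = "\<lambda>(x, \<delta>). (\<Sum>i<n. of_bool (\<delta> i) * (1 - eta (x i))) / max 1 (rejections n \<delta>)"
  let ?D = "\<lambda>(x, \<delta>). bin_deviation N n x"
  note [measurable] = bin_deviation_bounded(1)
  have iB: "integrable (Q n K) ?B"
  proof (rule integrable_Q[OF K, where C = n])
    fix p :: "(nat \<Rightarrow> 'a) \<times> (nat \<Rightarrow> bool)"
    have "\<bar>\<Sum>i<n. of_bool (snd p i) * eta (fst p i)\<bar> \<le> n"
      by (rule abs_sum_unit_le) (use eta_bounds in auto)
    then show "\<bar>?B p\<bar> \<le> n" by (simp add: case_prod_beta')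
  qed measurable
  have iF: "integrable (Q n K) ?F" by (rule integrable_FDP[OF K])
  have iD: "integrable (Q n K) ?D"
    by (rule integrable_Q[OF K, where C = "real (Suc N)"])
      (measurable, use bin_deviation_bounded(2)[of N n] bin_deviation_nonneg[of N n] in \<open>auto simp: abs_of_nonneg split: prod.split\<close>)
  have "true_positives n K / n = (\<integral>p. ?B p / n \<partial>Q n K)"
    by (simp add: true_positives_def)
  also have "\<dots> \<le> (\<integral>p. \<pi>1 - c + s * ?F p + \<epsilon> + (1 + s / \<epsilon>) * (1 / N + ?D p) \<partial>Q n K)"
  proof (rule integral_mono)
    fix p :: "(nat \<Rightarrow> 'a) \<times> (nat \<Rightarrow> bool)"
    show "?B p / n \<le> \<pi>1 - c + s * ?F p + \<epsilon> + (1 + s / \<epsilon>) * (1 / N + ?D p)"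
      using discoveries_le[OF N n s eps lin, of "snd p" "fst p"] by (simp add: case_prod_beta')
  qed (use iB iF iD in auto)
  also have "\<dots> = \<pi>1 - c + s * FDR \<pi>1 M f0 f1 n K + \<epsilon> + (1 + s / \<epsilon>) * (1 / N + (\<integral>p. ?D p \<partial>Q n K))"
    using iF iD by (simp add: Q.prob_space FDR_eq[OF K])
  also have "(\<integral>p. ?D p \<partial>Q n K) = (\<integral>x. bin_deviation N n x \<partial>P n)"
    by (rule integral_Q_data[OF K, where C = "real (Suc N)"])
      (use bin_deviation_bounded bin_deviation_nonneg in auto)
  also have "\<pi>1 - c + s * FDR \<pi>1 M f0 f1 n K + \<epsilon> + (1 + s / \<epsilon>) * (1 / N + (\<integral>x. bin_deviation N n x \<partial>P n)) \<le>
    \<pi>1 - c + s * FDR \<pi>1 M f0 f1 n K + \<epsilon> + (1 + s / \<epsilon>) * (1 / N + (N + 1) / sqrt n)"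
    by (intro add_left_mono mult_left_mono)
      (use s eps mean_bin_deviation[OF n, of N] in \<open>auto simp: add.commute\<close>)
  finally show ?thesis by (simp add: EFN_eq[OF K n])
qed

section \<open>The levels 0 and 1, and the lower bound in the limit\<close>

lemma mFDR_zero_of_FDR_zero:
  assumes K: "decision_rule M n K" and z: "FDR \<pi>1 M f0 f1 n K \<le> 0"
  shows "mFDR \<pi>1 M f0 f1 n K = 0"
proof -
  let ?F = "\<lambda>(x, \<delta>). (\<Sum>i<n. of_bool (\<delta> i) * (1 - eta (x i))) / max 1 (rejections n \<delta>)"
  have F0: "0 \<le> ?F p" for p
    using eta_bounds by (auto split: prod.split intro!: divide_nonneg_nonneg sum_nonneg)
  have iF: "integrable (Q n K) ?F" by (rule integrable_FDP[OF K])
  have "0 \<le> (\<integral>p. ?F p \<partial>Q n K)" by (rule Bochner_Integration.integral_nonneg) (rule F0)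
  then have "(\<integral>p. ?F p \<partial>Q n K) = 0" using z by (simp add: FDR_eq[OF K])
  then have "AE p in Q n K. ?F p = 0"
    by (subst (asm) integral_nonneg_eq_0_iff_AE[OF iF]) (use F0 in auto)
  then have "AE p in Q n K. (case p of (x, \<delta>) \<Rightarrow> (\<Sum>i<n. of_bool (\<delta> i) * (1 - eta (x i)))) = 0"
    by eventually_elim (auto simp: max_def split: if_splits prod.splits)
  then have "false_positives n K = 0"
    unfolding false_positives_def by (rule integral_eq_zero_AE)
  then show ?thesis by (simp add: mFDR_eq[OF K])
qed

text \<open>No limit is involved: together with \<open>EFN_opt_le_mEFN_opt\<close> the two optimal
  values agree at level 0 for every positive \<open>n\<close>.\<close>

lemma mEFN_opt_zero_le:
  assumes "1 \<le> n" "1 \<le> m"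
  shows "mEFN_opt \<pi>1 M f0 f1 m 0 \<le> EFN_opt \<pi>1 M f0 f1 n 0"
proof (rule EFN_opt_ge[OF order_refl assms(1)])
  fix K assume K: "decision_rule M n K" and z: "FDR \<pi>1 M f0 f1 n K \<le> 0"
  obtain \<phi> where \<phi>: "test \<phi>" "EFN \<pi>1 M f0 f1 n K = \<pi>1 - true_mass \<phi>"
    "mFDR \<pi>1 M f0 f1 n K = false_mass \<phi> / (false_mass \<phi> + true_mass \<phi>)"
    using rule_rates[OF K assms(1)] by blast
  have "false_mass \<phi> / (false_mass \<phi> + true_mass \<phi>) \<le> 0"
    unfolding \<phi>(3)[symmetric] mFDR_zero_of_FDR_zero[OF K z] by simp
  from mEFN_opt_le_test[OF \<phi>(1) assms(2) this]
  show "mEFN_opt \<pi>1 M f0 f1 m 0 \<le> EFN \<pi>1 M f0 f1 n K" by (simp add: \<phi>(2))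
qed

lemma mass_ratio_bounds:
  assumes "test \<phi>"
  shows "false_mass \<phi> / (false_mass \<phi> + true_mass \<phi>) \<in> {0..1}"
  using mass_nonneg[OF assms] by (auto simp: divide_le_eq_1)

text \<open>Rejecting everything leaves no false negative. Besides settling level 1, this forces
  supporting lines at positive values to slope downwards.\<close>

lemma mEFN_opt_one_le:
  assumes "1 \<le> m"
  shows "mEFN_opt \<pi>1 M f0 f1 m 1 \<le> 0"
proof -
  have t: "test (\<lambda>_. 1)" by (simp add: test_def)
  show ?thesis
    using mEFN_opt_le_test[OF t assms, of 1] mass_ratio_bounds[OF t] by (simp add: true_mass_def integral_eta)
qed

lemma EFN_opt_nonneg: "0 \<le> \<alpha> \<Longrightarrow> 1 \<le> n \<Longrightarrow> 0 \<le> EFN_opt \<pi>1 M f0 f1 n \<alpha>"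
  by (rule EFN_opt_ge) (auto intro: EFN_nonneg)

text \<open>\<open>C\<close> is an arbitrary competitor in the supremum that defines the minorant,
  so neither convexity of the minorant nor attainment of the supremum has to be shown. At an
  interior level \<open>C\<close> has a supporting line of finite slope.\<close>

lemma eventually_EFN_opt_gt_convex_minorant:
  assumes m: "1 \<le> m" and \<alpha>: "0 < \<alpha>" "\<alpha> < 1" and C: "convex_on {0..1} C"
    and Cle: "\<And>y. y \<in> {0..1} \<Longrightarrow> C y \<le> mEFN_opt \<pi>1 M f0 f1 m y" and e: "0 < e"
  shows "\<forall>\<^sub>F n in sequentially. C \<alpha> - e < EFN_opt \<pi>1 M f0 f1 n \<alpha>"
\<comment> \<open>A nonpositive value is below every rate anyway. In the other case
  \<open>C 1 \<le> 0 < C \<alpha>\<close> makes the supporting line fall, and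
  \<open>s \<ge> 0\<close> is what turns \<open>FDR \<le> \<alpha>\<close> into a lower bound on the
  EFN.\<close>
proof (cases "C \<alpha> \<le> 0")
  case True
  show ?thesis
    using eventually_ge_at_top[of 1]
  proof eventually_elim
    case (elim n)
    then show ?case using EFN_opt_nonneg[of \<alpha> n] \<alpha> True e by simp
  qed
next
  case False
  \<comment> \<open>The right derivative of \<open>C\<close> at \<alpha>, as an infimum of
    difference quotients.\<close>
  define \<sigma> where "\<sigma> = Inf ((\<lambda>t. (C \<alpha> - C t) / (\<alpha> - t)) ` ({\<alpha><..} \<inter> {0..1}))"
  have sup: "C \<alpha> + \<sigma> * (y - \<alpha>) \<le> C y" if "y \<in> {0..1}" for y
    unfolding \<sigma>_def by (rule convex_le_Inf_differential[OF C _ that]) (use \<alpha> in simp)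
  define s where "s = - \<sigma>"
  define c where "c = C \<alpha> + s * \<alpha>"
  have "C 1 \<le> 0" using Cle[of 1] mEFN_opt_one_le[OF m] by simp
  then have "\<sigma> * (1 - \<alpha>) < 0" using sup[of 1] False by simp
  then have s: "0 \<le> s" using \<alpha> by (simp add: s_def mult_less_0_iff)
  \<comment> \<open>The minorant is evaluated at the mFDR of the test itself, the level at which
    this test is just feasible.\<close>
  have lin: "c - s * (false_mass \<phi> / (false_mass \<phi> + true_mass \<phi>)) \<le> \<pi>1 - true_mass \<phi>" if "test \<phi>" for \<phi>
  proof -
    let ?y = "false_mass \<phi> / (false_mass \<phi> + true_mass \<phi>)"
    have "c - s * ?y = C \<alpha> + \<sigma> * (?y - \<alpha>)" by (simp add: c_def s_def algebra_simps)
    also have "\<dots> \<le> C ?y" by (rule sup[OF mass_ratio_bounds[OF that]])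
    also have "\<dots> \<le> mEFN_opt \<pi>1 M f0 f1 m ?y" by (rule Cle[OF mass_ratio_bounds[OF that]])
    also have "\<dots> \<le> \<pi>1 - true_mass \<phi>" by (rule mEFN_opt_le_test[OF that m order_refl])
    finally show ?thesis .
  qed
  \<comment> \<open>Three errors of at most \<epsilon> occur (few rejections, rounding, sampling);
    the fourth quarter of \<open>e\<close> gives the strict inequality. The order matters:
    \<epsilon> determines \<open>L\<close>, then \<open>N\<close> is chosen with
    \<open>L / N < \<epsilon>\<close>, and only then does \<open>n\<close> grow, because the
    sampling error involves \<open>N\<close>.\<close>
  define \<epsilon> where "\<epsilon> = e / 4"
  define L where "L = 1 + s / \<epsilon>"
  have eps: "0 < \<epsilon>" using e by (simp add: \<epsilon>_def)
  have L: "0 < L" using s eps by (simp add: L_def add_pos_nonneg)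
  obtain N0 :: nat where "L / \<epsilon> < N0" using reals_Archimedean2 by blast
  define N where "N = Suc N0"
  have N: "1 \<le> N" "L * (1 / N) < \<epsilon>"
  proof -
    have "L / \<epsilon> < real N" using \<open>L / \<epsilon> < N0\<close> by (simp add: N_def)
    then show "L * (1 / N) < \<epsilon>" using eps by (simp add: N_def field_simps)
  qed (simp add: N_def)
  have "(\<lambda>n. L * (real (N + 1) / sqrt (real n))) \<longlonglongrightarrow> L * 0"
    by (intro tendsto_mult_left real_tendsto_divide_at_top[OF tendsto_const]
        filterlim_compose[OF sqrt_at_top filterlim_real_sequentially])
  then have "\<forall>\<^sub>F n in sequentially. L * (real (N + 1) / sqrt (real n)) < \<epsilon>"
    using eps by (auto dest: order_tendstoD(2))
  then show ?thesis
    using eventually_ge_at_top[of 1]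
  proof eventually_elim
    case (elim n)
    have "C \<alpha> - 3 * \<epsilon> \<le> EFN_opt \<pi>1 M f0 f1 n \<alpha>"
    proof (rule EFN_opt_ge)
      fix K assume K: "decision_rule M n K" and F: "FDR \<pi>1 M f0 f1 n K \<le> \<alpha>"
      have "s * FDR \<pi>1 M f0 f1 n K \<le> s * \<alpha>" using F s by (rule mult_left_mono)
      moreover have "c - s * FDR \<pi>1 M f0 f1 n K - \<epsilon> - L * (1 / N + (N + 1) / sqrt n) \<le> EFN \<pi>1 M f0 f1 n K"
        unfolding L_def using K N elim s eps lin by (intro EFN_lower_bound) auto
      moreover have "L * (1 / N + (N + 1) / sqrt n) < 2 * \<epsilon>"
        using N elim by (simp add: distrib_left)
      ultimately show "C \<alpha> - 3 * \<epsilon> \<le> EFN \<pi>1 M f0 f1 n K" by (simp add: c_def)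
    qed (use \<alpha> elim in auto)
    then show ?case using e by (simp add: \<epsilon>_def)
  qed
qed

end

theorem theorem16:
  fixes \<pi>0 \<pi>1 :: real and M :: "'a measure" and f0 f1 :: "'a \<Rightarrow> real" and m :: nat
  assumes "0 < \<pi>0" "\<pi>0 < 1" and "0 < \<pi>1" "\<pi>1 < 1" and "\<pi>0 + \<pi>1 = 1"
    and "prob_density M f0" and "prob_density M f1"
    and "1 \<le> m"
  shows "\<forall>\<alpha>\<in>{0..1}. (\<lambda>n. EFN_opt \<pi>1 M f0 f1 n \<alpha>)
           \<longlonglongrightarrow> greatest_convex_minorant (mEFN_opt \<pi>1 M f0 f1 m) \<alpha>"
proof
  fix \<alpha> :: real assume \<alpha>: "\<alpha> \<in> {0..1}"
  interpret two_group \<pi>1 M f0 f1 by unfold_locales fact+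
  let ?h = "mEFN_opt \<pi>1 M f0 f1 m" and ?E = "\<lambda>n. EFN_opt \<pi>1 M f0 f1 n"
  let ?S = "{C \<alpha> |C. convex_on {0..1} C \<and> (\<forall>y\<in>{0..1}. C y \<le> ?h y)}"
  \<comment> \<open>Each \<open>?E n\<close> is itself a convex minorant of \<open>?h\<close>, hence
    a competitor in the supremum, so the upper bound holds for every positive \<open>n\<close>
    without a limit.\<close>
  have E_in: "?E n \<alpha> \<in> ?S" if "1 \<le> n" for n
    using convex_EFN_opt[OF that] EFN_opt_le_mEFN_opt[OF _ that assms(8)] by auto
  have bdd: "bdd_above ?S" using \<alpha> by (intro bdd_aboveI[of _ "?h \<alpha>"]) auto
  have upper: "?E n \<alpha> \<le> Sup ?S" if "1 \<le> n" for n
    by (rule cSup_upper[OF E_in[OF that] bdd])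
  have lower: "\<forall>\<^sub>F n in sequentially. Sup ?S - e < ?E n \<alpha>" if e: "0 < e" for e
  proof (cases "0 < \<alpha> \<and> \<alpha> < 1")
    case True
    have "?S \<noteq> {}" using E_in[OF order_refl] by blast
    \<comment> \<open>Half of \<open>e\<close> is spent on choosing a near-optimal minorant at this
      \<alpha>, the other half on the convergence for that minorant.\<close>
    then obtain v where v: "v \<in> ?S" "Sup ?S - e / 2 < v"
      using e less_cSupD[of ?S "Sup ?S - e / 2"] by auto
    then obtain C where C: "v = C \<alpha>" "convex_on {0..1} C" "\<And>y. y \<in> {0..1} \<Longrightarrow> C y \<le> ?h y" by blast
    have "\<forall>\<^sub>F n in sequentially. C \<alpha> - e / 2 < ?E n \<alpha>"
      using eventually_EFN_opt_gt_convex_minorant[OF assms(8) _ _ C(2,3), of \<alpha> "e / 2"] True e by simp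
    then show ?thesis by eventually_elim (use v C in simp)
  next
    case False
    text \<open>At the endpoints there may be no supporting line, but the rules attaining \<open>?h \<alpha>\<close> are explicit:
      FDR 0 forces mFDR 0, and at level 1 everything can be rejected.\<close>
    then consider "\<alpha> = 0" | "\<alpha> = 1" using \<alpha> by fastforce
    then have "?h \<alpha> \<le> ?E n \<alpha>" if "1 \<le> n" for n
      using mEFN_opt_zero_le[OF that assms(8)] mEFN_opt_one_le[OF assms(8)] EFN_opt_nonneg[OF _ that, of 1]
      by cases auto
    moreover have "Sup ?S \<le> ?h \<alpha>"
      using E_in[OF order_refl] \<alpha> by (intro cSup_least) auto
    ultimately have "Sup ?S - e < ?E n \<alpha>" if "1 \<le> n" for n
      using e that by (meson diff_less_eq less_add_same_cancel1 order_less_le_trans order_trans less_le_trans)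
    then show ?thesis by (intro eventually_at_top_linorderI[of 1])
  qed
  have "(\<lambda>n. ?E n \<alpha>) \<longlonglongrightarrow> Sup ?S"
  proof (rule order_tendstoI)
    fix a assume "a < Sup ?S"
    then show "\<forall>\<^sub>F n in sequentially. a < ?E n \<alpha>" using lower[of "Sup ?S - a"] by simp
  next
    fix a assume "Sup ?S < a"
    then show "\<forall>\<^sub>F n in sequentially. ?E n \<alpha> < a"
      using upper by (intro eventually_at_top_linorderI[of 1]) (auto intro: le_less_trans)
  qed
  then show "(\<lambda>n. ?E n \<alpha>) \<longlonglongrightarrow> greatest_convex_minorant ?h \<alpha>"
    by (simp add: greatest_convex_minorant_def)
qed

end
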